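(* Let $\rho>1$ and let $f$ be analytic inside and on the Bernstein ellipse $\mathcal{E}_\rho$; set $M=\max_{z\in\mathcal{E}_\rho}|f(z)|$ and let $L(\mathcal{E}_\rho)$ be the length of $\mathcal{E}_\rho$. If $-\tfrac12<\lambda\le1$, $\lambda\neq0$, then for all $n\ge0$ \[ |a_n^\lambda|\le\frac{|c_{n,\lambda}|\,M\,L(\mathcal{E}_\rho)}{\pi\rho^{n+1}}\;{}_2F_1\!\left[\begin{matrix} n+1,\ 1-\lambda\\ n+\lambda+1\end{matrix};\ \frac{1}{\rho^2}\right]. \] If $\lambda>1$, then for all $n\ge0$ \[ |a_n^\lambda|\le\frac{c_{n,\lambda}\,M\,L(\mathcal{E}_\rho)}{\pi\rho^{n+1}}\;{}_2F_1\!\left[\begin{matrix} n+1,\ 1-\lambda\\ n+\lambda+1\end{matrix};\ -\frac{1}{\rho^2}\right]. \] Here $c_{n,\lambda}=\Gamma(\lambda)\Gamma(n+1)/\Gamma(n+\lambda)$. Moreover, apart from constant factors, these bounds are optimal in the sense that they cannot be improved by any negative power of $n$: there is no $\delta>0$ and sequence $d_n=\mathcal{O}(n^{-\delta})$ such that $|a_n^\lambda|$ is bounded by $d_n$ times the respective right-hand side for all such $f$, $\rho$ and $n$.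
   Context: $C_n^{(\lambda)}$ is the Gegenbauer polynomial normalized by $C_n^{(\lambda)}(1)=\Gamma(n+2\lambda)/(n!\,\Gamma(2\lambda))$, orthogonal on $[-1,1]$ with weight $(1-x^2)^{\lambda-1/2}$, with $h_n^{(\lambda)}=\int_{-1}^1(1-x^2)^{\lambda-1/2}(C_n^{(\lambda)})^2dx=\frac{2^{1-2\lambda}\pi}{\Gamma(\lambda)^2}\frac{\Gamma(n+2\lambda)}{\Gamma(n+1)(n+\lambda)}$; the Gegenbauer coefficients of $f$ are $a_n^{\lambda}=\frac{1}{h_n^{(\lambda)}}\int_{-1}^1(1-x^2)^{\lambda-1/2}f(x)C_n^{(\lambda)}(x)\,dx$. $\mathcal{E}_\rho=\{\tfrac12(\rho e^{i\theta}+\rho^{-1}e^{-i\theta}):0\le\theta\le2\pi\}$. ${}_2F_1$ is the Gauss hypergeometric function. *)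

theory Defs
  imports "HOL-Analysis.Analysis" "HOL-Library.Landau_Symbols"
begin

text \<open>Gegenbauer polynomial C_n^(lam)(x), explicit sum representation
  C_n^(lam)(x) = sum_{k=0}^{n div 2} (-1)^k (lam)_(n-k) / (k! (n-2k)!) (2x)^(n-2k),
  where (lam)_m = Gamma(lam+m)/Gamma(lam) is the Pochhammer symbol.
  It satisfies C_n^(lam)(1) = Gamma(n+2 lam)/(n! Gamma(2 lam)).\<close>
definition gegenbauer :: "nat \<Rightarrow> real \<Rightarrow> real \<Rightarrow> real" where
  "gegenbauer n lam x =
     (\<Sum>k = 0..n div 2. (-1) ^ k * pochhammer lam (n - k)
        / (fact k * fact (n - 2 * k)) * (2 * x) ^ (n - 2 * k))"

definition gegenbauer_h :: "nat \<Rightarrow> real \<Rightarrow> real" where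
  "gegenbauer_h n lam =
     2 powr (1 - 2 * lam) * pi / (Gamma lam)\<^sup>2
       * Gamma (real n + 2 * lam) / (Gamma (real n + 1) * (real n + lam))"

definition gegenbauer_coeff :: "real \<Rightarrow> (complex \<Rightarrow> complex) \<Rightarrow> nat \<Rightarrow> complex" where
  "gegenbauer_coeff lam f n =
     complex_of_real (1 / gegenbauer_h n lam) *
       integral {-1..1} (\<lambda>x::real. complex_of_real ((1 - x\<^sup>2) powr (lam - 1/2) * gegenbauer n lam x)
                                   * f (complex_of_real x))"

definition bernstein_param :: "real \<Rightarrow> real \<Rightarrow> complex" where
  "bernstein_param rho \<theta> =
     (complex_of_real rho * exp (\<i> * complex_of_real \<theta>)
      + complex_of_real (1 / rho) * exp (- \<i> * complex_of_real \<theta>)) / 2"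

definition bernstein_ellipse :: "real \<Rightarrow> complex set" where
  "bernstein_ellipse rho = bernstein_param rho ` {0..2 * pi}"

text \<open>Closed region bounded by E_rho (ellipse with foci +-1 and sum of semi-axes rho):
  the ellipse together with its interior.\<close>
definition bernstein_region :: "real \<Rightarrow> complex set" where
  "bernstein_region rho = {z. cmod (z - 1) + cmod (z + 1) \<le> rho + 1 / rho}"

definition bernstein_length :: "real \<Rightarrow> real" where
  "bernstein_length rho =
     integral {0..2 * pi} (\<lambda>\<theta>. norm (vector_derivative (bernstein_param rho) (at \<theta>)))"

definition ellipse_max :: "real \<Rightarrow> (complex \<Rightarrow> complex) \<Rightarrow> real" where
  "ellipse_max rho f = Sup ((\<lambda>z. cmod (f z)) ` bernstein_ellipse rho)"

definition hyp2f1 :: "real \<Rightarrow> real \<Rightarrow> real \<Rightarrow> real \<Rightarrow> real" where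
  "hyp2f1 a b c z =
     (\<Sum>k. pochhammer a k * pochhammer b k / (pochhammer c k * fact k) * z ^ k)"

definition c_const :: "nat \<Rightarrow> real \<Rightarrow> real" where
  "c_const n lam = Gamma lam * Gamma (real n + 1) / Gamma (real n + lam)"

definition gegenbauer_bound :: "real \<Rightarrow> real \<Rightarrow> (complex \<Rightarrow> complex) \<Rightarrow> nat \<Rightarrow> real" where
  "gegenbauer_bound lam rho f n =
     (if lam \<le> 1 then
        \<bar>c_const n lam\<bar> * ellipse_max rho f * bernstein_length rho / (pi * rho ^ (n + 1))
          * hyp2f1 (real n + 1) (1 - lam) (real n + lam + 1) (1 / rho\<^sup>2)
      else
        c_const n lam * ellipse_max rho f * bernstein_length rho / (pi * rho ^ (n + 1))
          * hyp2f1 (real n + 1) (1 - lam) (real n + lam + 1) (- 1 / rho\<^sup>2))"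

end

(*
  Cauchy's formula on the ellipse z = (u + 1/u)/2, |u| = rho, together with
  1/(z - x) = 2 * sum_k U_k(x) u^(-k-1) (U_k Chebyshev of the second kind), expands f on [-1,1]
  in the U_k.  The integrals of (1-x^2)^(lam-1/2) C_n U_k follow from the three-term recurrences of
  both families; they vanish unless k = n + 2j, and the surviving ones are exactly h_n c_n times the
  coefficients of 2F1(n+1, 1-lam; n+lam+1).  Hence a_n = c_n/(pi i) * contour integral of
  f(z) u^(-n-1) 2F1(u^(-2)) dz, and it remains to bound |2F1(w)|: by 2F1(|w|) if lam <= 1, as the
  coefficients are nonnegative, and by 2F1(-|w|) if lam > 1, by Euler's integral.
  For optimality take f = U_n on a fixed ellipse: then a_n = c_n, while |U_n| is at most 2 rho^n and
  2F1 is at most 2 there, so the bound exceeds |a_n| only by a constant factor.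
*)
theory Submission
  imports Defs "HOL-Complex_Analysis.Complex_Analysis"
begin

section \<open>Chebyshev expansion on the Bernstein ellipse\<close>

text \<open>Expanding the kernel in U_k rather than in C_k keeps the powers of 1/u free of
  \<open>lam\<close>: the weight enters only through the moments, whose zero pattern (below the
  diagonal and at wrong parity) leaves a power series in u^(-2). The winding number of the ellipse
  is never computed geometrically: the expansion is first derived with it as an unknown factor, and
  the constant function 1, whose coefficients are elementary trigonometric integrals, shows that the
  factor is 1. For lam > 1 the coefficients of 2F1 change sign, and a termwise estimate can exceed
  2F1(-1/rho^2); hence the detour through an integral with nonnegative weight, where the triangle
  inequality is sharp at -|w|. In the optimality part c_n stands on both sides and cancels, so no
  asymptotics of Gamma enter, and the ellipse is chosen from \<open>lam\<close> alone, which makes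
  its length a constant.\<close>

text \<open>Dominated convergence with majorant (sum of B) * h. The two factors are kept apart so
  that h can be an unbounded weight while B carries the geometric decay; a constant h serves the
  integrals over the ellipse.\<close>

lemma integral_sums_dominated:
  fixes g :: "nat \<Rightarrow> real \<Rightarrow> 'b::euclidean_space"
  assumes g: "\<And>k. g k integrable_on S" and h: "h integrable_on S"
    and B: "summable B" "\<And>k. B k \<ge> 0"
    and h0: "\<And>x. x \<in> S \<Longrightarrow> h x \<ge> 0"
    and le: "\<And>k x. x \<in> S \<Longrightarrow> norm (g k x) \<le> B k * h x"
  shows "(\<lambda>x. \<Sum>k. g k x) integrable_on S"
    and "(\<lambda>k. integral S (g k)) sums integral S (\<lambda>x. \<Sum>k. g k x)"
proof -
  have i: "(\<lambda>x. \<Sum>k<N. g k x) integrable_on S" for N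
    by (intro integrable_sum g) auto
  have i2: "(\<lambda>x. suminf B * h x) integrable_on S"
    using integrable_on_cmult_left[OF h, of "suminf B"] by simp
  have b: "norm (\<Sum>k<N. g k x) \<le> suminf B * h x" if "x \<in> S" for N x
  proof -
    have "norm (\<Sum>k<N. g k x) \<le> (\<Sum>k<N. B k * h x)"
      by (intro order_trans[OF norm_sum] sum_mono le that)
    also have "\<dots> = (\<Sum>k<N. B k) * h x" by (simp add: sum_distrib_right)
    also have "\<dots> \<le> suminf B * h x"
      by (intro mult_right_mono sum_le_suminf B h0 that) auto
    finally show ?thesis .
  qed
  have c: "(\<lambda>N. \<Sum>k<N. g k x) \<longlonglongrightarrow> (\<Sum>k. g k x)" if "x \<in> S" for x
  proof -
    have "summable (\<lambda>k. g k x)"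
      by (rule summable_comparison_test'[where N=0 and g="\<lambda>k. B k * h x"])
         (use B le that in \<open>auto intro: summable_mult2\<close>)
    thus ?thesis by (simp add: summable_LIMSEQ)
  qed
  show "(\<lambda>x. \<Sum>k. g k x) integrable_on S"
    by (rule dominated_convergence(1)[OF i i2 b c])
  have "(\<lambda>N. integral S (\<lambda>x. \<Sum>k<N. g k x)) \<longlonglongrightarrow> integral S (\<lambda>x. \<Sum>k. g k x)"
    by (rule dominated_convergence(2)[OF i i2 b c])
  also have "(\<lambda>N. integral S (\<lambda>x. \<Sum>k<N. g k x)) = (\<lambda>N. \<Sum>k<N. integral S (g k))"
    by (intro ext integral_sum g) auto
  finally show "(\<lambda>k. integral S (g k)) sums integral S (\<lambda>x. \<Sum>k. g k x)"
    by (simp add: sums_def)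
qed

section \<open>Chebyshev polynomials of the second kind: growth and generating function\<close>

fun chebU :: "nat \<Rightarrow> 'a::comm_ring_1 \<Rightarrow> 'a" where
  "chebU 0 x = 1"
| "chebU (Suc 0) x = 2 * x"
| "chebU (Suc (Suc n)) x = 2 * x * chebU (Suc n) x - chebU n x"

lemma chebU_of_real: "chebU n (of_real x) = of_real (chebU n x)"
  by (induction n x rule: chebU.induct) auto

lemma continuous_on_chebU: "continuous_on S (chebU n :: real \<Rightarrow> real)"
proof -
  have "continuous_on S (\<lambda>x. chebU n x :: real)"
    by (induction n rule: induct_nat_012) (auto intro!: continuous_intros)
  thus ?thesis by simp
qed

lemma chebU_analytic: "(chebU n :: complex \<Rightarrow> complex) analytic_on S"
proof -
  have "(\<lambda>x. chebU n x :: complex) analytic_on S"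
    by (induction n rule: induct_nat_012) (auto intro!: analytic_intros)
  thus ?thesis by simp
qed

text \<open>One-step form of U_n = (u^(n+1) - u^(-n-1)) / (u - u^(-1)). Without the division it also
  covers u = 1 and u = -1, the end points of [-1,1], and it bounds U_n by induction.\<close>

lemma chebU_Suc_joukowski:
  fixes u :: "'a::field_char_0"
  assumes "u \<noteq> 0"
  shows "chebU (Suc n) ((u + inverse u) / 2) = u * chebU n ((u + inverse u) / 2) + inverse u ^ Suc n"
proof (induction n)
  case (Suc n)
  have "chebU (Suc (Suc n)) ((u + inverse u) / 2)
     = (u + inverse u) * chebU (Suc n) ((u + inverse u) / 2) - chebU n ((u + inverse u) / 2)"
    by simp
  also have "\<dots> = u * chebU (Suc n) ((u + inverse u) / 2)
      + inverse u * (chebU (Suc n) ((u + inverse u) / 2) - u * chebU n ((u + inverse u) / 2))"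
    using assms by (simp add: algebra_simps del: chebU.simps)
  also have "\<dots> = u * chebU (Suc n) ((u + inverse u) / 2) + inverse u ^ Suc (Suc n)"
    by (simp add: Suc del: chebU.simps)
  finally show ?case .
qed simp

text \<open>For x = cos t take u = cis t: by the one-step form, each degree adds a term of modulus
  1.\<close>

lemma abs_chebU_le:
  assumes "x \<in> {-1..1::real}"
  shows "\<bar>chebU n x\<bar> \<le> real n + 1"
proof -
  define u where "u = cis (arccos x)"
  have u: "norm u = 1" "u \<noteq> 0" by (auto simp: u_def)
  have x: "complex_of_real x = (u + inverse u) / 2"
    using assms by (auto simp: u_def complex_eq_iff cis_inverse)
  have "norm (chebU n (complex_of_real x)) \<le> real n + 1"
  proof (induction n)
    case (Suc n)
    have "norm (chebU (Suc n) (complex_of_real x)) \<le> norm (u * chebU n (complex_of_real x)) + norm (inverse u ^ Suc n)"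
      unfolding x chebU_Suc_joukowski[OF u(2)] by (rule norm_triangle_ineq)
    also have "\<dots> \<le> real (Suc n) + 1"
      using Suc u by (simp add: norm_mult norm_power norm_inverse)
    finally show ?case .
  qed simp
  thus ?thesis by (simp add: chebU_of_real)
qed

lemma norm_chebU_joukowski_le:
  fixes u :: complex
  assumes "norm u \<ge> 2"
  shows "norm (chebU n ((u + inverse u) / 2)) \<le> 2 * norm u ^ n"
proof -
  define r where "r = norm u"
  have r: "r \<ge> 2" and u: "u \<noteq> 0" using assms by (auto simp: r_def)
  \<comment> \<open>Strengthened for the induction: the subtracted power absorbs the new summand
    r^(-n-1), because 2 / r <= r for r >= 2. At n = 0 both sides are 1.\<close>
  have "norm (chebU n ((u + inverse u) / 2)) \<le> 2 * r ^ n - inverse r ^ n"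
  proof (induction n)
    case (Suc n)
    have "norm (chebU (Suc n) ((u + inverse u) / 2)) \<le> norm (u * chebU n ((u + inverse u) / 2)) + norm (inverse u ^ Suc n)"
      unfolding chebU_Suc_joukowski[OF u] by (rule norm_triangle_ineq)
    also have "\<dots> \<le> r * (2 * r ^ n - inverse r ^ n) + inverse r ^ Suc n"
      using Suc r by (simp add: norm_mult norm_power norm_inverse r_def[symmetric] mult_left_mono)
    also have "\<dots> \<le> 2 * r ^ Suc n - inverse r ^ Suc n"
    proof -
      have "2 * inverse r \<le> r"
        using r mult_mono[OF r r] by (simp add: field_simps)
      hence "(2 * inverse r) * inverse r ^ n \<le> r * inverse r ^ n"
        by (rule mult_right_mono) (use r in auto)
      thus ?thesis by (simp add: algebra_simps)
    qed
    finally show ?case .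
  qed simp
  also have "\<dots> \<le> 2 * r ^ n" using r by simp
  finally show ?thesis by (simp add: r_def)
qed

lemma summable_Suc_times_power:
  fixes v :: real
  assumes "0 \<le> v" "v < 1"
  shows "summable (\<lambda>k. (real k + 1) * v ^ (k + 1))"
proof -
  have "summable (\<lambda>k. of_nat (Suc k) * v ^ k)"
    using geometric_deriv_sums[of v] assms by (auto simp: sums_iff)
  from summable_mult[OF this, of v] show ?thesis
    by (simp add: algebra_simps)
qed

text \<open>Generating function of the U_k at v = 1/u: the three-term recurrence, applied to the
  shifted series, gives a linear equation for the sum, S * (1 - 2 x v + v^2) = v.\<close>

lemma cauchy_kernel_sums:
  fixes u :: complex
  assumes u: "norm u > 1" and x: "x \<in> {-1..1::real}"
  shows "(\<lambda>k. 2 * of_real (chebU k x) * inverse u ^ (k + 1)) sums (1 / ((u + inverse u) / 2 - of_real x))"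
    (is "?f sums _")
proof -
  define v where "v = inverse u"
  have v: "norm v < 1" "v \<noteq> 0" using u by (auto simp: v_def norm_inverse inverse_less_1_iff)
  have sm: "summable (\<lambda>k. of_real (chebU k x) * v ^ (k + 1))"
  proof (rule summable_comparison_test'[where N=0])
    show "summable (\<lambda>k. (real k + 1) * norm v ^ (k + 1))"
      using v by (intro summable_Suc_times_power) auto
    show "norm (of_real (chebU k x) * v ^ (k + 1)) \<le> (real k + 1) * norm v ^ (k + 1)" for k
      unfolding norm_mult norm_power norm_of_real real_norm_def
      by (intro mult_right_mono abs_chebU_le x) auto
  qed
  define S where "S = (\<Sum>k. of_real (chebU k x) * v ^ (k + 1))"
  let ?g = "\<lambda>k. of_real (chebU k x) * v ^ (k + 1) :: complex"
  have s0: "?g sums S" using sm by (simp add: S_def summable_sums)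
  have s1: "(\<lambda>k. ?g (Suc k)) sums (S - v)"
    using s0 by (subst sums_Suc_iff) simp
  have s2: "(\<lambda>k. ?g (Suc (Suc k))) sums (S - v - 2 * of_real x * v ^ 2)"
    using s1 by (subst sums_Suc_iff) (simp add: power2_eq_square algebra_simps)
  have "(\<lambda>k. 2 * of_real x * v * ?g (Suc k) - v^2 * ?g k) sums (2 * of_real x * v * (S - v) - v^2 * S)"
    by (intro sums_diff sums_mult s0 s1)
  also have "(\<lambda>k. 2 * of_real x * v * ?g (Suc k) - v^2 * ?g k) = (\<lambda>k. ?g (Suc (Suc k)))"
    by (auto simp: fun_eq_iff algebra_simps power2_eq_square)
  finally have "S - v - 2 * of_real x * v ^ 2 = 2 * of_real x * v * (S - v) - v^2 * S"
    using s2 sums_unique2 by blast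
  hence e: "S * (1 - 2 * of_real x * v + v^2) = v"
    by (simp add: algebra_simps power2_eq_square)
  have ux: "u = inverse v" by (simp add: v_def)
  \<comment> \<open>The equation for S itself excludes a zero of the quadratic, since v is
    nonzero.\<close>
  have nz: "1 - 2 * of_real x * v + v^2 \<noteq> 0" using e v by auto
  have "(u + inverse u) / 2 - of_real x = (1 - 2 * of_real x * v + v^2) / (2 * v)"
    using v by (simp add: ux field_simps power2_eq_square)
  hence "1 / ((u + inverse u) / 2 - of_real x) = 2 * v / (1 - 2 * of_real x * v + v^2)"
    by simp
  also have "\<dots> = 2 * S" using e nz by (metis (no_types, lifting) mult.assoc nonzero_mult_div_cancel_right)
  finally show ?thesis
    using sums_mult[OF s0, of 2] by (simp add: v_def mult.assoc)
qed

section \<open>The ellipse as image of the circle |u| = rho\<close>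

definition ellipse_u :: "real \<Rightarrow> real \<Rightarrow> complex" where
  "ellipse_u rho t = of_real rho * cis t"

text \<open>The derivative of z = (u + 1/u) / 2 in t, using du/dt = i u. Written through u, it
  combines directly with the powers u^(-k-1).\<close>

definition ellipse_deriv :: "real \<Rightarrow> real \<Rightarrow> complex" where
  "ellipse_deriv rho t = \<i> * (ellipse_u rho t - inverse (ellipse_u rho t)) / 2"

lemma norm_ellipse_u: "rho > 1 \<Longrightarrow> norm (ellipse_u rho t) = rho"
  by (simp add: ellipse_u_def norm_mult)

lemma ellipse_u_nz: "rho > 1 \<Longrightarrow> ellipse_u rho t \<noteq> 0"
  using norm_ellipse_u[of rho t] by auto

lemma bernstein_param_eq:
  "rho > 1 \<Longrightarrow> bernstein_param rho t = (ellipse_u rho t + inverse (ellipse_u rho t)) / 2"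
  by (simp add: bernstein_param_def ellipse_u_def cis_conv_exp exp_minus field_simps)

lemma continuous_ellipse_u [continuous_intros]: "continuous_on S (ellipse_u rho)"
  unfolding ellipse_u_def by (intro continuous_intros)

lemma continuous_ellipse_deriv [continuous_intros]: "rho > 1 \<Longrightarrow> continuous_on S (ellipse_deriv rho)"
  unfolding ellipse_deriv_def by (intro continuous_intros) (auto simp: ellipse_u_nz)

lemma continuous_bernstein_param [continuous_intros]: "rho > 1 \<Longrightarrow> continuous_on S (bernstein_param rho)"
  unfolding bernstein_param_def by (intro continuous_intros) auto

lemma bernstein_param_deriv:
  assumes "rho > 1"
  shows "(bernstein_param rho has_vector_derivative ellipse_deriv rho t) (at t within S)"
proof -
  have "((\<lambda>z. (of_real rho * exp (\<i> * z) + of_real (1 / rho) * exp (- \<i> * z)) / 2)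
          has_field_derivative ellipse_deriv rho t) (at (of_real t))"
    using assms
    by (auto intro!: derivative_eq_intros
             simp: ellipse_deriv_def ellipse_u_def cis_conv_exp exp_minus field_simps)
  from has_vector_derivative_real_field[OF this] show ?thesis
    by (simp add: bernstein_param_def[abs_def])
qed

lemma bernstein_length_eq:
  assumes "rho > 1"
  shows "bernstein_length rho = integral {0..2 * pi} (\<lambda>t. norm (ellipse_deriv rho t))"
  using vector_derivative_at[OF bernstein_param_deriv[OF assms]] by (simp add: bernstein_length_def)

text \<open>With u = s^2 one has z - 1 = (s - 1/s)^2 / 2 and z + 1 = (s + 1/s)^2 / 2, so both focal
  distances are squared moduli up to the factor 1/2, and the parallelogram law adds them up.\<close>

lemma bernstein_param_dist_sum:
  assumes "rho > 1"
  shows "norm (bernstein_param rho t - 1) + norm (bernstein_param rho t + 1) = rho + 1 / rho"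
proof -
  define s where "s = of_real (sqrt rho) * cis (t / 2)"
  have s: "s\<^sup>2 = ellipse_u rho t" "s \<noteq> 0" "(norm s)\<^sup>2 = rho"
    using assms by (auto simp: s_def ellipse_u_def power_mult_distrib norm_mult Complex.DeMoivre
        simp flip: of_real_power)
  have 1: "bernstein_param rho t - 1 = (s - inverse s)\<^sup>2 / 2"
    using s(2) by (simp add: bernstein_param_eq[OF assms] s(1)[symmetric] power2_eq_square field_simps)
  have 2: "bernstein_param rho t + 1 = (s + inverse s)\<^sup>2 / 2"
    using s(2) by (simp add: bernstein_param_eq[OF assms] s(1)[symmetric] power2_eq_square field_simps)
  have "(norm (s + inverse s))\<^sup>2 + (norm (s - inverse s))\<^sup>2 = 2 * (norm s)\<^sup>2 + 2 * (norm (inverse s))\<^sup>2"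
    unfolding cmod_power2 by (simp add: power2_eq_square algebra_simps)
  also have "\<dots> = 2 * (rho + 1 / rho)"
    using s by (simp add: norm_inverse power_inverse inverse_eq_divide[of rho])
  finally show ?thesis unfolding 1 2 by (simp add: norm_divide norm_power)
qed

lemma bernstein_ellipse_subset: "rho > 1 \<Longrightarrow> bernstein_ellipse rho \<subseteq> bernstein_region rho"
  using bernstein_param_dist_sum by (auto simp: bernstein_ellipse_def bernstein_region_def)

lemma two_less_add_inverse: "rho > 1 \<Longrightarrow> (2::real) < rho + 1 / rho"
  using zero_less_power2[of "rho - 1"] by (simp add: field_simps power2_eq_square)

text \<open>A sum of two distance functions is convex, hence so are its sublevel sets. Convexity is
  what the version of Cauchy's formula in \<open>cheb_expansion\<close> asks of the region.\<close>

lemma convex_bernstein_region: "convex (bernstein_region rho)"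
proof -
  have c: "convex_on UNIV (\<lambda>z::complex. dist 1 z + dist (-1) z)"
    by (intro convex_on_add convex_on_dist) auto
  have "convex {z. dist (1::complex) z + dist (-1) z \<le> K}" for K
  proof (rule convexI)
    fix x y :: complex and u v :: real
    assume *: "x \<in> {z. dist 1 z + dist (-1) z \<le> K}" "y \<in> {z. dist 1 z + dist (-1) z \<le> K}"
      "0 \<le> u" "0 \<le> v" "u + v = 1"
    have "dist 1 (u *\<^sub>R x + v *\<^sub>R y) + dist (-1) (u *\<^sub>R x + v *\<^sub>R y)
        \<le> u * (dist 1 x + dist (-1) x) + v * (dist 1 y + dist (-1) y)"
      using c * unfolding convex_on_def by blast
    also have "\<dots> \<le> u * K + v * K"
      using * by (intro add_mono mult_left_mono) auto
    also have "\<dots> = K" using * by (metis distrib_right mult_1)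
    finally show "u *\<^sub>R x + v *\<^sub>R y \<in> {z. dist 1 z + dist (-1) z \<le> K}" by simp
  qed
  moreover have "bernstein_region rho = {z. dist 1 z + dist (-1) z \<le> rho + 1 / rho}"
    unfolding bernstein_region_def dist_commute[of "1 :: complex"] dist_commute[of "-1 :: complex"] by (simp add: dist_norm)
  ultimately show ?thesis by simp
qed

text \<open>Between the foci the two distances add up to exactly 2, which lies below rho + 1/rho
  because (rho - 1)^2 > 0.\<close>

lemma interior_bernstein_region:
  assumes "rho > 1" "x \<in> {-1..1}"
  shows "of_real x \<in> interior (bernstein_region rho)"
proof (rule interiorI)
  show "open {z. cmod (z - 1) + cmod (z + 1) < rho + 1 / rho}"
    by (intro open_Collect_less continuous_intros)
  have "complex_of_real x - 1 = of_real (x - 1)" "complex_of_real x + 1 = of_real (x + 1)" by auto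
  hence "cmod (complex_of_real x - 1) + cmod (complex_of_real x + 1) = 2"
    using assms(2) by (simp only: norm_of_real) auto
  thus "of_real x \<in> {z. cmod (z - 1) + cmod (z + 1) < rho + 1 / rho}"
    using two_less_add_inverse[OF assms(1)] by simp
qed (auto simp: bernstein_region_def)

lemma bernstein_ellipse_neq:
  assumes "rho > 1" "x \<in> {-1..1}"
  shows "bernstein_param rho t \<noteq> of_real x"
proof
  assume *: "bernstein_param rho t = of_real x"
  have "complex_of_real x - 1 = of_real (x - 1)" "complex_of_real x + 1 = of_real (x + 1)" by auto
  hence "cmod (complex_of_real x - 1) + cmod (complex_of_real x + 1) = 2"
    using assms(2) by (simp only: norm_of_real) auto
  thus False
    using two_less_add_inverse[OF assms(1)] bernstein_param_dist_sum[OF assms(1), of t] * by simp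
qed

section \<open>Cauchy's formula as an expansion in U_k\<close>

definition ellipse_coeff :: "real \<Rightarrow> (complex \<Rightarrow> complex) \<Rightarrow> nat \<Rightarrow> complex" where
  "ellipse_coeff rho f k = 1 / (of_real pi * \<i>) *
     integral {0..2 * pi} (\<lambda>t. f (bernstein_param rho t) * ellipse_deriv rho t * inverse (ellipse_u rho t) ^ (k + 1))"

lemma ellipse_param_bound:
  assumes rho: "rho > 1" and f: "continuous_on (bernstein_ellipse rho) f"
  obtains B where "B \<ge> 0" "\<And>t. t \<in> {0..2*pi} \<Longrightarrow> norm (f (bernstein_param rho t) * ellipse_deriv rho t) \<le> B"
    "continuous_on {0..2*pi} (\<lambda>t. f (bernstein_param rho t) * ellipse_deriv rho t)"
proof -
  have c: "continuous_on {0..2*pi} (\<lambda>t. f (bernstein_param rho t) * ellipse_deriv rho t)"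
    using rho f by (auto intro!: continuous_intros continuous_on_compose2[OF f] simp: bernstein_ellipse_def)
  hence "bounded ((\<lambda>t. f (bernstein_param rho t) * ellipse_deriv rho t) ` {0..2*pi})"
    using compact_continuous_image compact_imp_bounded by blast
  then obtain B where "B > 0" "\<forall>t \<in> {0..2*pi}. norm (f (bernstein_param rho t) * ellipse_deriv rho t) \<le> B"
    unfolding bounded_pos by auto
  thus ?thesis using c that[of B] by auto
qed

lemma norm_ellipse_coeff_le:
  assumes rho: "rho > 1" and f: "continuous_on (bernstein_ellipse rho) f"
  obtains B where "B \<ge> 0" "\<And>k. norm (ellipse_coeff rho f k) \<le> B * inverse rho ^ (k + 1)"
proof -
  obtain B where B: "B \<ge> 0" "\<And>t. t \<in> {0..2*pi} \<Longrightarrow> norm (f (bernstein_param rho t) * ellipse_deriv rho t) \<le> B"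
    "continuous_on {0..2*pi} (\<lambda>t. f (bernstein_param rho t) * ellipse_deriv rho t)"
    using ellipse_param_bound[OF assms] by blast
  have "norm (ellipse_coeff rho f k) \<le> 2 * B * inverse rho ^ (k + 1)" for k
  proof -
    have "norm (integral {0..2 * pi} (\<lambda>t. f (bernstein_param rho t) * ellipse_deriv rho t * inverse (ellipse_u rho t) ^ (k + 1)))
        \<le> B * inverse rho ^ (k + 1) * (2 * pi - 0)"
    proof (rule integral_bound)
      show "continuous_on {0..2 * pi} (\<lambda>t. f (bernstein_param rho t) * ellipse_deriv rho t * inverse (ellipse_u rho t) ^ (k + 1))"
        using rho by (intro continuous_intros B) (auto simp: ellipse_u_nz)
      show "norm (f (bernstein_param rho t) * ellipse_deriv rho t * inverse (ellipse_u rho t) ^ (k + 1))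
          \<le> B * inverse rho ^ (k + 1)" if "t \<in> {0..2*pi}" for t
        unfolding norm_mult[of _ "inverse _ ^ _"] norm_power norm_inverse norm_ellipse_u[OF rho]
        using B(2)[OF that] rho by (intro mult_right_mono) auto
    qed auto
    thus ?thesis
      by (simp add: ellipse_coeff_def norm_mult norm_divide field_simps)
  qed
  thus ?thesis using that[of "2 * B"] B(1) by auto
qed

text \<open>Up to a constant, the kernel series is dominated by (k + 1) * rho^(-k-1), uniformly on
  the ellipse. The factor 2 of the kernel turns 1 / (2 pi i) into the 1 / (pi i) of
  \<open>ellipse_coeff\<close>. Continuity on the ellipse suffices here; analyticity enters with
  Cauchy's formula.\<close>

lemma cauchy_kernel_integral_sums:
  assumes rho: "rho > 1" and f: "continuous_on (bernstein_ellipse rho) f" and x: "x \<in> {-1..1}"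
  shows "(\<lambda>k. ellipse_coeff rho f k * of_real (chebU k x)) sums
     (1 / (2 * of_real pi * \<i>) * integral {0..2*pi} (\<lambda>t. f (bernstein_param rho t) * ellipse_deriv rho t / (bernstein_param rho t - of_real x)))"
proof -
  obtain B where B: "B \<ge> 0" "\<And>t. t \<in> {0..2*pi} \<Longrightarrow> norm (f (bernstein_param rho t) * ellipse_deriv rho t) \<le> B"
    "continuous_on {0..2*pi} (\<lambda>t. f (bernstein_param rho t) * ellipse_deriv rho t)"
    using ellipse_param_bound[OF rho f] by blast
  define F where "F = (\<lambda>t. f (bernstein_param rho t) * ellipse_deriv rho t)"
  define g where "g = (\<lambda>k t. F t * (2 * of_real (chebU k x) * inverse (ellipse_u rho t) ^ (k + 1)))"
  have "(\<lambda>k. integral {0..2*pi} (g k)) sums integral {0..2*pi} (\<lambda>t. \<Sum>k. g k t)"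
  proof (rule integral_sums_dominated(2))
    show "g k integrable_on {0..2 * pi}" for k
      unfolding g_def using rho B(3)
      by (intro integrable_continuous_interval continuous_intros) (auto simp: ellipse_u_nz F_def)
    show "(\<lambda>t. 2 * B) integrable_on {0..2 * pi}" by auto
    show "summable (\<lambda>k. (real k + 1) * inverse rho ^ (k + 1))"
      using rho by (intro summable_Suc_times_power) (auto simp: inverse_less_1_iff)
    show "(real k + 1) * inverse rho ^ (k + 1) \<ge> 0" for k using rho by simp
    show "norm (g k t) \<le> (real k + 1) * inverse rho ^ (k + 1) * (2 * B)" if "t \<in> {0..2*pi}" for k t
    proof -
      have "norm (g k t) = norm (F t) * (2 * \<bar>chebU k x\<bar> * inverse rho ^ (k + 1))"
        using rho by (simp add: g_def norm_mult norm_power norm_inverse norm_ellipse_u)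
      also have "\<dots> \<le> B * (2 * (real k + 1) * inverse rho ^ (k + 1))"
        using rho B(2)[OF that] abs_chebU_le[OF x, of k] unfolding F_def
        by (intro mult_mono mult_right_mono mult_left_mono) (auto simp: B)
      finally show ?thesis by (simp only: mult_ac)
    qed
  qed (use B in auto)
  also have "(\<lambda>t. \<Sum>k. g k t) = (\<lambda>t. F t / (bernstein_param rho t - of_real x))"
  proof
    fix t
    have "(\<lambda>k. g k t) sums (F t * (1 / (bernstein_param rho t - of_real x)))"
      unfolding g_def bernstein_param_eq[OF rho] using rho
      by (intro sums_mult cauchy_kernel_sums x) (auto simp: norm_ellipse_u)
    thus "(\<Sum>k. g k t) = F t / (bernstein_param rho t - of_real x)"
      by (simp add: sums_iff)
  qed
  finally have "(\<lambda>k. 1 / (2 * of_real pi * \<i>) * integral {0..2*pi} (g k)) sums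
      (1 / (2 * of_real pi * \<i>) * integral {0..2*pi} (\<lambda>t. F t / (bernstein_param rho t - of_real x)))"
    by (rule sums_mult)
  also have "(\<lambda>k. 1 / (2 * of_real pi * \<i>) * integral {0..2*pi} (g k)) = (\<lambda>k. ellipse_coeff rho f k * of_real (chebU k x))"
  proof
    fix k
    have "g k = (\<lambda>t. (F t * inverse (ellipse_u rho t) ^ (k + 1)) * (2 * of_real (chebU k x)))"
      by (simp add: g_def mult_ac)
    hence "integral {0..2*pi} (g k) = integral {0..2*pi} (\<lambda>t. F t * inverse (ellipse_u rho t) ^ (k + 1)) * (2 * of_real (chebU k x))"
      by (simp only: integral_mult_left)
    thus "1 / (2 * of_real pi * \<i>) * integral {0..2*pi} (g k) = ellipse_coeff rho f k * of_real (chebU k x)"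
      by (simp add: ellipse_coeff_def F_def)
  qed
  finally show ?thesis by (simp add: F_def)
qed

lemma integral_cis_multiple:
  "integral {0..2*pi} (\<lambda>t. cis (of_int m * t)) = (if m = 0 then 2 * of_real pi else 0)"
proof (cases "m = 0")
  case False
  have "((\<lambda>t. cis (of_int m * t)) has_integral
     (cis (of_int m * (2 * pi)) / (\<i> * of_int m) - cis (of_int m * 0) / (\<i> * of_int m))) {0..2*pi}"
  proof (rule fundamental_theorem_of_calculus)
    fix t :: real
    have "((\<lambda>z. exp (\<i> * of_int m * z) / (\<i> * of_int m)) has_field_derivative cis (of_int m * t)) (at (of_real t))"
      using False by (auto intro!: derivative_eq_intros simp: cis_conv_exp mult.assoc)
    from has_vector_derivative_real_field[OF this]
    show "((\<lambda>t. cis (of_int m * t) / (\<i> * of_int m)) has_vector_derivative cis (of_int m * t)) (at t within {0..2*pi})"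
      by (simp add: cis_conv_exp mult.assoc)
  qed auto
  moreover have "cis (of_int m * (2 * pi)) = 1"
    by (metis cis_multiple_2pi Ints_of_int mult.commute)
  ultimately show ?thesis using False by (simp add: integral_unique)
qed (simp add: scaleR_conv_of_real)

text \<open>The integrand is a difference of exponentials of frequencies -k and -(k + 2), so only k
  = 0 survives. This is the test case that fixes the winding number in
  \<open>cheb_expansion\<close>.\<close>

lemma ellipse_coeff_one:
  assumes rho: "rho > 1"
  shows "ellipse_coeff rho (\<lambda>_. 1) k = (if k = 0 then 1 else 0)"
proof -
  have e: "ellipse_deriv rho t * inverse (ellipse_u rho t) ^ (k + 1) =
     \<i> / 2 * (inverse (of_real rho) ^ k * cis (of_int (- int k) * t) - inverse (of_real rho) ^ (k + 2) * cis (of_int (- int (k + 2)) * t))" for t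
  proof -
    have p: "inverse (ellipse_u rho t) ^ j = inverse (of_real rho) ^ j * cis (of_int (- int j) * t)" for j
      by (simp add: ellipse_u_def power_mult_distrib cis_inverse Complex.DeMoivre)
    have "ellipse_deriv rho t * inverse (ellipse_u rho t) ^ (k + 1) =
      \<i> / 2 * (inverse (ellipse_u rho t) ^ k - inverse (ellipse_u rho t) ^ (k + 2))"
      using ellipse_u_nz[OF rho, of t] by (simp add: ellipse_deriv_def field_simps)
    thus ?thesis unfolding p .
  qed
  have i: "(\<lambda>t. cis (of_int m * t)) integrable_on {0..2*pi}" for m
    by (intro integrable_continuous_interval continuous_intros)
  have "integral {0..2*pi} (\<lambda>t. ellipse_deriv rho t * inverse (ellipse_u rho t) ^ (k + 1)) =
    \<i> / 2 * (inverse (of_real rho) ^ k * integral {0..2*pi} (\<lambda>t. cis (of_int (- int k) * t)) - inverse (of_real rho) ^ (k + 2) * integral {0..2*pi} (\<lambda>t. cis (of_int (- int (k + 2)) * t)))"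
    unfolding e integral_mult_right
    by (subst integral_diff) (intro integrable_on_mult_right i, intro integrable_on_mult_right i, simp only: integral_mult_right)
  also have "\<dots> = (if k = 0 then \<i> * of_real pi else 0)"
    unfolding integral_cis_multiple by auto
  finally show ?thesis by (simp add: ellipse_coeff_def)
qed

lemma cheb_expansion:
  assumes rho: "rho > 1" and f: "f analytic_on bernstein_region rho" and x: "x \<in> {-1..1}"
  shows "(\<lambda>k. ellipse_coeff rho f k * of_real (chebU k x)) sums f (of_real x)"
proof -
  \<comment> \<open>Contour integrals run over [0,1], hence the rescaled parameter;
    \<open>ci\<close> converts back to [0, 2 pi].\<close>
  define \<gamma> where "\<gamma> = (\<lambda>t. bernstein_param rho (2 * pi * t))"
  have der: "(\<gamma> has_vector_derivative 2 * of_real pi * ellipse_deriv rho (2 * pi * t)) (at t within S)" for t S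
  proof -
    have "((bernstein_param rho \<circ> (\<lambda>t. 2 * pi * t)) has_vector_derivative (2 * pi) *\<^sub>R ellipse_deriv rho (2 * pi * t)) (at t within S)"
      by (rule vector_diff_chain_within) (auto intro!: derivative_eq_intros bernstein_param_deriv rho simp: has_vector_derivative_mult_right)
    thus ?thesis by (simp add: \<gamma>_def o_def scaleR_conv_of_real)
  qed
  have vp: "valid_path \<gamma>"
    unfolding valid_path_def
  proof (rule C1_differentiable_imp_piecewise)
    show "\<gamma> C1_differentiable_on {0..1}"
      unfolding C1_differentiable_on_def
      by (rule exI[of _ "\<lambda>t. 2 * of_real pi * ellipse_deriv rho (2 * pi * t)"])
         (auto intro!: der continuous_intros continuous_on_compose2[OF continuous_ellipse_deriv[OF rho, of UNIV]])
  qed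
  have loop: "pathfinish \<gamma> = pathstart \<gamma>"
    by (simp add: \<gamma>_def pathfinish_def pathstart_def bernstein_param_eq[OF rho] ellipse_u_def cis.code)
  have img: "path_image \<gamma> \<subseteq> bernstein_region rho - {of_real x}"
    using bernstein_param_dist_sum[OF rho] bernstein_ellipse_neq[OF rho x]
    by (auto simp: path_image_def \<gamma>_def bernstein_region_def)
  have ci: "contour_integral \<gamma> (\<lambda>w. g w / (w - of_real x)) =
     integral {0..2*pi} (\<lambda>t. g (bernstein_param rho t) * ellipse_deriv rho t / (bernstein_param rho t - of_real x))"
    for g
  proof -
    let ?h = "\<lambda>t. g (bernstein_param rho t) * ellipse_deriv rho t / (bernstein_param rho t - of_real x)"
    have "contour_integral \<gamma> (\<lambda>w. g w / (w - of_real x)) = integral {0..1} (\<lambda>t. (2 * pi) *\<^sub>R ?h (2 * pi * t))"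
      unfolding contour_integral_integral vector_derivative_at[OF der]
      by (simp add: \<gamma>_def scaleR_conv_of_real mult_ac)
    also have "\<dots> = integral {0..2*pi} ?h"
      using integral_stretch_real[of "2 * pi" 0 "2 * pi" ?h]
      by (simp add: image_divide_atLeastAtMost integral_cmul del: scaleR_conv_of_real)
    finally show ?thesis .
  qed
  \<comment> \<open>Kept general in g, because both f and the constant 1 are inserted.\<close>
  have S: "(\<lambda>k. ellipse_coeff rho g k * of_real (chebU k x)) sums (winding_number \<gamma> (of_real x) * g (of_real x))"
    if g: "g analytic_on bernstein_region rho" for g
  proof -
    have hol: "g holomorphic_on bernstein_region rho" using g by (rule analytic_imp_holomorphic)
    have cont: "continuous_on (bernstein_ellipse rho) g"
      using hol holomorphic_on_imp_continuous_on continuous_on_subset bernstein_ellipse_subset[OF rho] by blast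
    have "((\<lambda>w. g w / (w - of_real x)) has_contour_integral (2*pi * \<i> * winding_number \<gamma> (of_real x) * g (of_real x))) \<gamma>"
      by (rule Cauchy_integral_formula_convex_simple[OF convex_bernstein_region hol interior_bernstein_region[OF rho x] vp img loop])
    hence "contour_integral \<gamma> (\<lambda>w. g w / (w - of_real x)) = 2*pi * \<i> * winding_number \<gamma> (of_real x) * g (of_real x)"
      by (rule contour_integral_unique)
    thus ?thesis using cauchy_kernel_integral_sums[OF rho cont x] by (simp add: ci)
  qed
  \<comment> \<open>For the constant 1 the series is explicitly known to sum to 1, so uniqueness of
    sums forces the winding number to be 1.\<close>
  have "(\<lambda>k. ellipse_coeff rho (\<lambda>_. 1) k * of_real (chebU k x)) sums (winding_number \<gamma> (of_real x) * 1)"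
    by (rule S) auto
  moreover have "(\<lambda>k. ellipse_coeff rho (\<lambda>_. 1) k * of_real (chebU k x)) sums 1"
    unfolding ellipse_coeff_one[OF rho] using sums_single[of 0 "\<lambda>_. 1::complex"]
    by (auto simp: if_distrib cong: if_cong elim!: sums_cong[THEN iffD1, rotated])
  ultimately have "winding_number \<gamma> (of_real x) = 1" using sums_unique2 by fastforce
  thus ?thesis using S[OF f] by simp
qed

section \<open>Moments of Gegenbauer polynomials\<close>

definition gegenbauer_moment :: "real \<Rightarrow> nat \<Rightarrow> nat \<Rightarrow> real" where
  "gegenbauer_moment lam n k = integral {-1..1} (\<lambda>x. (1 - x\<^sup>2) powr (lam - 1/2) * (gegenbauer n lam x * chebU k x))"

text \<open>Substituting x = 2 t - 1 gives 1 - x^2 = 4 t (1 - t), hence a Beta integral, convergent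
  because lam + 1/2 > 0.\<close>

lemma weight_has_integral:
  assumes "lam > -1/2"
  shows "((\<lambda>x::real. (1 - x\<^sup>2) powr (lam - 1/2)) has_integral 2 powr (2 * lam) * Beta (lam + 1/2) (lam + 1/2)) {-1..1}"
proof -
  let ?B = "Beta (lam + 1/2) (lam + 1/2)"
  have B: "((\<lambda>t. t powr (lam - 1/2) * (1 - t) powr (lam - 1/2)) has_integral ?B) (cbox 0 1)"
    using has_integral_Beta_real[of "lam + 1/2" "lam + 1/2"] assms by (simp add: algebra_simps)
  have img: "(\<lambda>x. (1 / (1 / 2)) *\<^sub>R x + - ((1 / (1 / 2)) *\<^sub>R (1 / 2))) ` cbox 0 1 = {-1..1::real}"
    using image_affinity_atLeastAtMost[of 2 "-1" 0 "1::real"] by simp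
  from has_integral_affinity[OF B, of "1/2" "1/2", unfolded img]
  have "((\<lambda>x. (x / 2 + 1 / 2) powr (lam - 1/2) * (1 - (x / 2 + 1 / 2)) powr (lam - 1/2)) has_integral 2 * ?B) {-1..1::real}"
    by (simp add: algebra_simps)
  hence "((\<lambda>x. 4 powr (lam - 1/2) * ((x / 2 + 1 / 2) powr (lam - 1/2) * (1 - (x / 2 + 1 / 2)) powr (lam - 1/2))) has_integral 4 powr (lam - 1/2) * (2 * ?B)) {-1..1::real}"
    by (rule has_integral_mult_right)
  also have "?this \<longleftrightarrow> ((\<lambda>x::real. (1 - x\<^sup>2) powr (lam - 1/2)) has_integral 4 powr (lam - 1/2) * (2 * ?B)) {-1..1}"
  proof (rule has_integral_cong)
    fix x :: real
    have "1 - x\<^sup>2 = 4 * ((x / 2 + 1 / 2) * (1 - (x / 2 + 1 / 2)))"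
      by (simp add: power2_eq_square field_simps)
    thus "4 powr (lam - 1/2) * ((x / 2 + 1 / 2) powr (lam - 1/2) * (1 - (x / 2 + 1 / 2)) powr (lam - 1/2)) = (1 - x\<^sup>2) powr (lam - 1/2)"
      by (simp only: powr_mult)
  qed
  also have "4 powr (lam - 1/2) * 2 = (2 powr 2) powr (lam - 1/2) * 2 powr 1" by simp
  hence "4 powr (lam - 1/2) * (2 * ?B) = 2 powr (2 * lam) * ?B"
    unfolding powr_powr powr_add[symmetric] by (simp add: algebra_simps)
  finally show ?thesis .
qed

text \<open>For lam < 1/2 the weight is unbounded at the end points, so continuity does not give
  integrability. Being nonnegative and integrable, the weight is absolutely integrable, and a
  bounded measurable factor preserves this.\<close>

lemma weight_absolutely_integrable:
  assumes lam: "lam > -1/2" and p: "continuous_on {-1..1} p"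
  shows "(\<lambda>x::real. (1 - x\<^sup>2) powr (lam - 1/2) * p x) absolutely_integrable_on {-1..1}"
proof -
  have w: "(\<lambda>x::real. (1 - x\<^sup>2) powr (lam - 1/2)) absolutely_integrable_on {-1..1}"
    by (intro nonnegative_absolutely_integrable_1 has_integral_integrable[OF weight_has_integral[OF lam]]) auto
  have "(\<lambda>x::real. p x * (1 - x\<^sup>2) powr (lam - 1/2)) absolutely_integrable_on {-1..1}"
    by (intro absolutely_integrable_bounded_measurable_product_real w continuous_imp_measurable_on_sets_lebesgue p
          compact_imp_bounded compact_continuous_image) auto
  thus ?thesis by (simp add: mult.commute)
qed

lemma weight_integrable:
  assumes lam: "lam > -1/2" and p: "continuous_on {-1..1} p"
  shows "(\<lambda>x::real. (1 - x\<^sup>2) powr (lam - 1/2) * p x) integrable_on {-1..1}"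
  using weight_absolutely_integrable[OF assms] set_lebesgue_integral_eq_integral(1) by blast

text \<open>The threshold -1 fits 2 * lam, the lowest Gamma argument that occurs; the only
  nonpositive integer above it is 0.\<close>

lemma notin_nonpos_Ints_gt: "x > -1 \<Longrightarrow> x \<noteq> 0 \<Longrightarrow> (x::real) \<notin> \<int>\<^sub>\<le>\<^sub>0"
  by (auto elim!: nonpos_Ints_cases)

text \<open>\<open>\<integral> (1-x\<^sup>2)\<^bsup>\<lambda>-1/2\<^esup> C\<^sub>n\<^bsup>(\<lambda>)\<^esup> U\<^bsub>n+2j\<^esub> dx\<close>; all other moments against \<open>U\<^sub>k\<close> vanish.\<close>
definition moment_closed :: "real \<Rightarrow> nat \<Rightarrow> nat \<Rightarrow> real" where
  "moment_closed lam n j = 2 powr (1 - 2 * lam) * pi / Gamma lam * Gamma (real n + 2 * lam) * fact (n + j)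
     * pochhammer (1 - lam) j / (fact n * fact j * Gamma (real n + real j + lam + 1))"

text \<open>Legendre's duplication formula removes Gamma (lam + 1/2) from the Beta value in favour
  of Gamma at lam and 2 lam.\<close>

lemma weight_integral:
  assumes "lam > -1/2" "lam \<noteq> 0"
  shows "integral {-1..1} (\<lambda>x::real. (1 - x\<^sup>2) powr (lam - 1/2)) = moment_closed lam 0 0"
proof -
  have nn: "lam \<notin> \<int>\<^sub>\<le>\<^sub>0" "2 * lam \<notin> \<int>\<^sub>\<le>\<^sub>0" "lam + 1/2 \<notin> \<int>\<^sub>\<le>\<^sub>0"
    using assms by (intro notin_nonpos_Ints_gt; simp)+
  define D :: real where "D = 2 powr (1 - 2 * lam)"
  have "exp ((1 - 2 * lam) * ln 2) = D" by (simp add: D_def powr_def)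
  hence dup: "Gamma lam * Gamma (lam + 1/2) = D * sqrt pi * Gamma (2 * lam)"
  proof -
    \<comment> \<open>The duplication formula is a complex one; all its ingredients are images of
      real numbers, so it descends to the reals.\<close>
    have h: "complex_of_real lam + 1 / 2 = of_real (lam + 1/2)" "2 * complex_of_real lam = of_real (2 * lam)"
      "exp ((1 - complex_of_real (2 * lam)) * complex_of_real (ln 2)) = of_real (exp ((1 - 2 * lam) * ln 2))"
      by (simp_all flip: exp_of_real)
    have "complex_of_real lam \<notin> \<int>\<^sub>\<le>\<^sub>0" "complex_of_real lam + 1 / 2 \<notin> \<int>\<^sub>\<le>\<^sub>0"
      unfolding h of_real_in_nonpos_Ints_iff by (fact nn(1), fact nn(3))
    from Gamma_legendre_duplication[OF this, unfolded h Gamma_complex_of_real]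
    have "complex_of_real (Gamma lam * Gamma (lam + 1/2)) = of_real (exp ((1 - 2 * lam) * ln 2) * sqrt pi * Gamma (2 * lam))"
      by (simp only: of_real_mult)
    thus ?thesis using \<open>exp _ = D\<close> unfolding of_real_eq_iff by simp
  qed
  have D: "D * 2 powr (2 * lam) = 2" unfolding D_def powr_add[symmetric] by simp
  have G1: "Gamma (lam + 1) = lam * Gamma lam" "Gamma (2 * lam + 1) = 2 * lam * Gamma (2 * lam)"
    using nn Gamma_plus1 by blast+
  have nz: "Gamma lam \<noteq> 0" "Gamma (2 * lam) \<noteq> 0" using nn by (auto simp: Gamma_eq_zero_iff)
  have e: "Gamma (lam + 1/2) = D * sqrt pi * Gamma (2 * lam) / Gamma lam"
    using dup nz by (simp add: field_simps)
  have "2 powr (2 * lam) * Beta (lam + 1/2) (lam + 1/2) =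
      2 powr (2 * lam) * Gamma (lam + 1/2) ^ 2 / Gamma (2 * lam + 1)"
    by (simp add: Beta_def power2_eq_square algebra_simps)
  also have "\<dots> = (D * 2 powr (2 * lam)) * D * pi * Gamma (2 * lam) / (2 * lam * (Gamma lam)\<^sup>2)"
    unfolding e G1 using nz assms by (simp add: field_simps power2_eq_square)
  also have "\<dots> = moment_closed lam 0 0"
    unfolding D moment_closed_def using G1 nz by (simp add: D_def power2_eq_square ac_simps)
  finally show ?thesis using weight_has_integral[OF assms(1)] by (simp add: integral_unique)
qed

section \<open>Three-term recurrence of the Gegenbauer polynomials\<close>

definition gegenbauer_term :: "real \<Rightarrow> real \<Rightarrow> nat \<Rightarrow> nat \<Rightarrow> real" where
  "gegenbauer_term lam y n k = (if 2 * k \<le> n then (-1) ^ k * pochhammer lam (n - k)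
        / (fact k * fact (n - 2 * k)) * y ^ (n - 2 * k) else 0)"

text \<open>Padding the summands with zeros beyond n div 2 frees the summation range from the parity
  of n, so that consecutive degrees can be summed over matching ranges.\<close>

lemma gegenbauer_eq_sum:
  assumes "n \<le> 2 * N + 1"
  shows "gegenbauer n lam x = (\<Sum>k\<le>N. gegenbauer_term lam (2 * x) n k)"
proof -
  have "gegenbauer n lam x = (\<Sum>k\<le>n div 2. gegenbauer_term lam (2 * x) n k)"
    unfolding gegenbauer_def atLeast0AtMost by (intro sum.cong) (auto simp: gegenbauer_term_def)
  also have "\<dots> = (\<Sum>k\<le>N. gegenbauer_term lam (2 * x) n k)"
    by (rule sum.mono_neutral_left) (use assms in \<open>auto simp: gegenbauer_term_def\<close>)
  finally show ?thesis .
qed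

text \<open>The recurrence already holds power by power: y^(n-2k) occurs at index k + 1 in degree n
  + 2, at index k + 1 in degree n + 1 (after multiplication by y) and at index k in degree
  n.\<close>

lemma gegenbauer_term_rec:
  "(real n + 2) * gegenbauer_term lam y (n + 2) (Suc k) =
     (real n + 1 + lam) * y * gegenbauer_term lam y (n + 1) (Suc k) - (real n + 2 * lam) * gegenbauer_term lam y n k"
proof (cases "2 * k \<le> n")
  case True
  then obtain m where n: "n = m + 2 * k" by (metis le_add_diff_inverse2)
  have s: "n - k = m + k" "n + 2 - Suc k = Suc (m + k)" "n + 2 - 2 * Suc k = m" "n - 2 * k = m"
     "n + 1 - Suc k = m + k" "n + 1 - 2 * Suc k = m - 1" by (auto simp: n)
  have r: "real n = real m + 2 * real k" by (simp add: n)
  show ?thesis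
  proof (cases m)
    \<comment> \<open>Here n = 2 k, so degree n + 1 has no term of index k + 1 and only two terms
      remain.\<close>
    case 0
    thus ?thesis using s unfolding gegenbauer_term_def r
      by (simp add: n pochhammer_Suc) (simp add: divide_simps, simp add: algebra_simps)
  next
    case (Suc i)
    define P where "P = pochhammer lam (m + k)"
    have t: "gegenbauer_term lam y (n + 2) (Suc k) = (-1) ^ Suc k * (P * (lam + real (m + k))) / (fact (Suc k) * fact m) * y ^ m"
       "gegenbauer_term lam y (n + 1) (Suc k) = (-1) ^ Suc k * P / (fact (Suc k) * fact i) * y ^ i"
       "gegenbauer_term lam y n k = (-1) ^ k * P / (fact k * fact m) * y ^ m"
      unfolding gegenbauer_term_def s P_def using Suc by (simp_all add: n pochhammer_Suc)
    show ?thesis unfolding t r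
      by (simp add: Suc) (simp add: divide_simps, simp add: algebra_simps)
  qed
qed (auto simp: gegenbauer_term_def)

lemma gegenbauer_rec:
  "(real n + 2) * gegenbauer (n + 2) lam x =
     (real n + 1 + lam) * (2 * x) * gegenbauer (n + 1) lam x - (real n + 2 * lam) * gegenbauer n lam x"
proof -
  let ?t = "gegenbauer_term lam (2 * x)"
  \<comment> \<open>The leading power has no partner in degree n.\<close>
  have 0: "(real n + 2) * ?t (n + 2) 0 = (real n + 1 + lam) * (2 * x) * ?t (n + 1) 0"
    by (simp add: gegenbauer_term_def pochhammer_Suc divide_simps) (simp add: algebra_simps)
  have "(real n + 2) * gegenbauer (n + 2) lam x = (\<Sum>k\<le>Suc n. (real n + 2) * ?t (n + 2) k)"
    by (subst gegenbauer_eq_sum[of _ "Suc n"]) (auto simp: sum_distrib_left simp del: sum.atMost_Suc)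
  also have "\<dots> = (real n + 2) * ?t (n + 2) 0 + (\<Sum>k\<le>n. (real n + 2) * ?t (n + 2) (Suc k))"
    by (rule sum.atMost_Suc_shift)
  also have "\<dots> = ((real n + 1 + lam) * (2 * x) * ?t (n + 1) 0 + (\<Sum>k\<le>n. (real n + 1 + lam) * (2 * x) * ?t (n + 1) (Suc k)))
      - (\<Sum>k\<le>n. (real n + 2 * lam) * ?t n k)"
    unfolding gegenbauer_term_rec 0 sum_subtractf by simp
  also have "(real n + 1 + lam) * (2 * x) * ?t (n + 1) 0 + (\<Sum>k\<le>n. (real n + 1 + lam) * (2 * x) * ?t (n + 1) (Suc k))
     = (\<Sum>k\<le>Suc n. (real n + 1 + lam) * (2 * x) * ?t (n + 1) k)"
    by (rule sum.atMost_Suc_shift[symmetric])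
  also have "\<dots> = (real n + 1 + lam) * (2 * x) * gegenbauer (n + 1) lam x"
    by (subst gegenbauer_eq_sum[of _ "Suc n"]) (auto simp: sum_distrib_left simp del: sum.atMost_Suc)
  also have "(\<Sum>k\<le>n. (real n + 2 * lam) * ?t n k) = (real n + 2 * lam) * gegenbauer n lam x"
    by (subst gegenbauer_eq_sum[of _ "n"]) (auto simp: sum_distrib_left)
  finally show ?thesis .
qed

lemma gegenbauer_0 [simp]: "gegenbauer 0 lam x = 1"
  and gegenbauer_1: "gegenbauer 1 lam x = 2 * lam * x"
  by (simp_all add: gegenbauer_def)

lemma continuous_on_gegenbauer [continuous_intros]: "continuous_on S (gegenbauer n lam)"
proof -
  have "continuous_on S (\<lambda>x. gegenbauer n lam x)"
    unfolding gegenbauer_def by (intro continuous_intros) auto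
  thus ?thesis by simp
qed

text \<open>The factor 1 - x^2 keeps the right-hand side down to two polynomials; in
  \<open>gegenbauer_moment_0_rec\<close> it comes from lowering the exponent lam + 1/2 to lam - 1/2.
  Degree Suc k keeps the lower neighbour within the index range.\<close>

lemma chebU_derivative:
  "\<exists>D. (chebU (Suc k) has_real_derivative D) (at x) \<and>
     2 * (1 - x\<^sup>2) * D = (real k + 3) * chebU k x - (real k + 1) * chebU (k + 2) x"
proof (induction k rule: induct_nat_012)
  case 0
  show ?case by (rule exI[of _ 2]) (auto intro!: derivative_eq_intros simp: power2_eq_square algebra_simps)
next
  case 1
  show ?case by (rule exI[of _ "8 * x"]) (auto intro!: derivative_eq_intros simp: numeral_2_eq_2 power2_eq_square algebra_simps)
next
  case (ge2 k)
  from ge2(1) obtain D where D: "(chebU (Suc k) has_real_derivative D) (at x)"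
     "2 * (1 - x\<^sup>2) * D = (real k + 3) * chebU k x - (real k + 1) * chebU (k + 2) x" by blast
  from ge2(2) obtain E where E: "(chebU (Suc (Suc k)) has_real_derivative E) (at x)"
     "2 * (1 - x\<^sup>2) * E = (real (Suc k) + 3) * chebU (Suc k) x - (real (Suc k) + 1) * chebU (Suc k + 2) x" by blast
  have "((\<lambda>x. 2 * x * chebU (Suc (Suc k)) x - chebU (Suc k) x) has_real_derivative
       (2 * chebU (Suc (Suc k)) x + E * (2 * x) - D)) (at x)"
    using D E by (intro derivative_eq_intros DERIV_mult) (rule refl | assumption | simp del: chebU.simps)+
  moreover have "chebU (Suc (Suc (Suc k))) = (\<lambda>x::real. 2 * x * chebU (Suc (Suc k)) x - chebU (Suc k) x)"
    by (rule ext) simp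
  ultimately have d: "(chebU (Suc (Suc (Suc k))) has_real_derivative (2 * chebU (Suc (Suc k)) x + 2 * x * E - D)) (at x)"
    by (simp only: mult.commute)
  have "2 * (1 - x\<^sup>2) * (2 * chebU (Suc (Suc k)) x + 2 * x * E - D) =
     4 * (1 - x\<^sup>2) * chebU (Suc (Suc k)) x + 2 * x * (2 * (1 - x\<^sup>2) * E) - 2 * (1 - x\<^sup>2) * D"
    by (simp add: algebra_simps)
  also have "\<dots> = (real (Suc (Suc k)) + 3) * chebU (Suc (Suc k)) x - (real (Suc (Suc k)) + 1) * chebU (Suc (Suc k) + 2) x"
    unfolding D(2) E(2) by (simp add: power2_eq_square algebra_simps)
  finally show ?case using d by blast
qed

text \<open>Integrates the derivative of (1 - x^2)^(lam + 1/2) * U_(k+1). This function vanishes at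
  both ends because lam + 1/2 > 0, and its derivative is the weight times a combination of U_k and
  U_(k+2).\<close>

lemma gegenbauer_moment_0_rec:
  assumes lam: "lam > -1/2"
  shows "(real k + 2 + 2 * lam) * gegenbauer_moment lam 0 (k + 2) = (real k + 2 - 2 * lam) * gegenbauer_moment lam 0 k"
proof -
  let ?w = "\<lambda>x::real. (1 - x\<^sup>2) powr (lam - 1/2)"
  let ?U = "\<lambda>k x. chebU k x :: real"
  let ?p = "\<lambda>x. (1 - x\<^sup>2) powr (lam + 1/2) * ?U (Suc k) x"
  have "((\<lambda>x. 1 / 2 * (?w x * ((real k + 2 - 2 * lam) * ?U k x - (real k + 2 + 2 * lam) * ?U (k + 2) x))) has_integral ?p 1 - ?p (-1)) {-1..1}"
  \<comment> \<open>The power of 1 - x^2 need not be differentiable at -1 and 1; continuity there is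
    enough.\<close>
  proof (rule fundamental_theorem_of_calculus_interior)
    show "continuous_on {-1..1} ?p"
      using lam by (intro continuous_intros continuous_on_powr' continuous_on_chebU) (auto simp: abs_square_le_1)
    fix x :: real assume x: "x \<in> {-1<..<1}"
    hence pos: "1 - x\<^sup>2 > 0" by (auto simp: abs_square_less_1)
    obtain D where D: "(chebU (Suc k) has_real_derivative D) (at x)"
       "2 * (1 - x\<^sup>2) * D = (real k + 3) * ?U k x - (real k + 1) * ?U (k + 2) x" using chebU_derivative by blast
    have pw: "(1 - x\<^sup>2) powr (lam + 1/2) = ?w x * (1 - x\<^sup>2)"
      using pos powr_add[of "1 - x\<^sup>2" "lam - 1/2" 1] by (simp add: add.commute)
    have "((\<lambda>x. (1 - x\<^sup>2) powr (lam + 1/2)) has_real_derivative (lam + 1/2) * ?w x * (- 2 * x)) (at x)"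
      using pos by (auto intro!: derivative_eq_intros simp: powr_diff field_simps)
    from DERIV_mult[OF this D(1)]
    have "(?p has_real_derivative (lam + 1/2) * ?w x * (- 2 * x) * ?U (Suc k) x + D * (1 - x\<^sup>2) powr (lam + 1/2)) (at x)" .
    also have "(lam + 1/2) * ?w x * (- 2 * x) * ?U (Suc k) x + D * (1 - x\<^sup>2) powr (lam + 1/2) =
       ?w x / 2 * (2 * (1 - x\<^sup>2) * D - (2 * lam + 1) * (2 * x * ?U (Suc k) x))"
      unfolding pw by (simp add: algebra_simps)
    also have "\<dots> = 1 / 2 * (?w x * ((real k + 2 - 2 * lam) * ?U k x - (real k + 2 + 2 * lam) * ?U (k + 2) x))"
      unfolding D(2) by (simp add: algebra_simps)
    finally show "(?p has_vector_derivative 1 / 2 * (?w x * ((real k + 2 - 2 * lam) * ?U k x - (real k + 2 + 2 * lam) * ?U (k + 2) x))) (at x)"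
      by (simp add: has_real_derivative_iff_has_vector_derivative)
  qed auto
  also have "?p 1 - ?p (-1) = 0" using lam by simp
  finally have "integral {-1..1} (\<lambda>x. 1 / 2 * (?w x * ((real k + 2 - 2 * lam) * ?U k x - (real k + 2 + 2 * lam) * ?U (k + 2) x))) = 0"
    by (rule integral_unique)
  hence "integral {-1..1} (\<lambda>x. ?w x * ((real k + 2 - 2 * lam) * ?U k x - (real k + 2 + 2 * lam) * ?U (k + 2) x)) = 0"
    by (simp only: integral_mult_right)
  also have "(\<lambda>x. ?w x * ((real k + 2 - 2 * lam) * ?U k x - (real k + 2 + 2 * lam) * ?U (k + 2) x)) =
    (\<lambda>x. (real k + 2 - 2 * lam) * (?w x * ?U k x) - (real k + 2 + 2 * lam) * (?w x * ?U (k + 2) x))"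
    by (simp add: algebra_simps)
  also have "integral {-1..1} \<dots> = (real k + 2 - 2 * lam) * integral {-1..1} (\<lambda>x. ?w x * ?U k x) - (real k + 2 + 2 * lam) * integral {-1..1} (\<lambda>x. ?w x * ?U (k + 2) x)"
    by (subst integral_diff[OF integrable_on_mult_right integrable_on_mult_right])
       (simp_all only: integral_mult_right weight_integrable[OF lam continuous_on_chebU])
  finally show ?thesis by (simp add: gegenbauer_moment_def)
qed

lemma integral_odd_eq_0:
  fixes f :: "real \<Rightarrow> real"
  assumes "\<And>x. f (-x) = - f x"
  shows "integral {-a..a} f = 0"
  using Henstock_Kurzweil_Integration.integral_reflect_real[of a "-a" f] assms by simp

text \<open>Extends \<open>moment_closed\<close> by zeros to all k, so that the moment recurrences
  can be checked index by index. The guard n <= k protects the truncated subtraction.\<close>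

definition moment_table :: "real \<Rightarrow> nat \<Rightarrow> nat \<Rightarrow> real" where
  "moment_table lam n k = (if n \<le> k \<and> even (k - n) then moment_closed lam n ((k - n) div 2) else 0)"

lemma moment_table_diag: "moment_table lam n (n + 2 * j) = moment_closed lam n j"
  by (simp add: moment_table_def)

text \<open>The recurrence in steps of two starts from the integral of the weight and from an odd
  integrand; it can be solved for the next moment because k + 2 + 2 lam > 0.\<close>

lemma gegenbauer_moment_0:
  assumes lam: "lam > -1/2" "lam \<noteq> 0"
  shows "gegenbauer_moment lam 0 k = moment_table lam 0 k"
proof (induction k rule: induct_nat_012)
  case 0
  show ?case using weight_integral[OF lam] by (simp add: gegenbauer_moment_def moment_table_def)
next
  case 1
  show ?case by (simp add: gegenbauer_moment_def moment_table_def integral_odd_eq_0)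
next
  case (ge2 k)
  have pos: "real k + 2 + 2 * lam > 0" using lam by simp
  have "(real k + 2 + 2 * lam) * moment_table lam 0 (Suc (Suc k)) = (real k + 2 - 2 * lam) * moment_table lam 0 k"
  proof (cases "even k")
    case True
    then obtain j where k: "k = 2 * j" by blast
    have G: "Gamma (real j + lam + 1 + 1) = (real j + lam + 1) * Gamma (real j + lam + 1)"
      using lam by (intro Gamma_plus1 notin_nonpos_Ints_gt) auto
    have nz: "Gamma (real j + lam + 1) > 0" "real j + lam + 1 > 0" using lam by (auto intro!: Gamma_real_pos)
    have "moment_closed lam 0 (Suc j) = 2 powr (1 - 2 * lam) * pi / Gamma lam * Gamma (2 * lam) * pochhammer (1 - lam) j * (real j + 1 - lam) / ((real j + lam + 1) * Gamma (real j + lam + 1))"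
      unfolding G[symmetric] by (simp add: moment_closed_def pochhammer_Suc ac_simps)
    moreover have "moment_closed lam 0 j = 2 powr (1 - 2 * lam) * pi / Gamma lam * Gamma (2 * lam) * pochhammer (1 - lam) j / (Gamma (real j + lam + 1))"
      by (simp add: moment_closed_def)
    moreover have "real k + 2 + 2 * lam = 2 * (real j + lam + 1)" "real k + 2 - 2 * lam = 2 * (real j + 1 - lam)" by (auto simp: k)
    ultimately have "(real k + 2 + 2 * lam) * moment_closed lam 0 (Suc j) = (real k + 2 - 2 * lam) * moment_closed lam 0 j"
      using nz by (simp only: mult.assoc) (simp add: divide_simps)
    thus ?thesis by (simp add: moment_table_def k)
  qed (auto simp: moment_table_def)
  hence "(real k + 2 + 2 * lam) * gegenbauer_moment lam 0 (Suc (Suc k)) = (real k + 2 + 2 * lam) * moment_table lam 0 (Suc (Suc k))"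
    using gegenbauer_moment_0_rec[OF lam(1), of k] ge2 by simp
  thus ?case using pos by (simp only: mult_cancel_left) auto
qed

section \<open>Two-index recurrence for the moments\<close>

definition chebU_pred :: "nat \<Rightarrow> real \<Rightarrow> real" where
  "chebU_pred k x = (case k of 0 \<Rightarrow> 0 | Suc k \<Rightarrow> chebU k x)"

text \<open>\<open>chebU_pred\<close> is U_(k-1) with U_(-1) = 0, which makes the product rule
  uniform in k.\<close>

lemma two_x_chebU: "2 * x * chebU k x = chebU (Suc k) x + chebU_pred k x"
  by (cases k) (auto simp: chebU_pred_def)

lemma continuous_on_chebU_pred: "continuous_on S (chebU_pred k)"
  by (cases k) (auto simp: chebU_pred_def[abs_def] continuous_on_chebU)

definition gegenbauer_moment_pred :: "real \<Rightarrow> nat \<Rightarrow> nat \<Rightarrow> real" where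
  "gegenbauer_moment_pred lam n k = integral {-1..1} (\<lambda>x. (1 - x\<^sup>2) powr (lam - 1/2) * (gegenbauer n lam x * chebU_pred k x))"

lemma gegenbauer_moment_pred_eq: "gegenbauer_moment_pred lam n k = (case k of 0 \<Rightarrow> 0 | Suc k \<Rightarrow> gegenbauer_moment lam n k)"
  by (cases k) (auto simp: gegenbauer_moment_pred_def gegenbauer_moment_def chebU_pred_def)

text \<open>Moves the factor 2 x of the Gegenbauer recurrence onto U_k, where it only shifts the
  index; thus the moments satisfy a recurrence among themselves.\<close>

lemma moment_sum:
  assumes lam: "lam > -1/2"
  shows "integral {-1..1} (\<lambda>x. (1 - x\<^sup>2) powr (lam - 1/2) * (2 * x * gegenbauer n lam x * chebU k x)) =
    gegenbauer_moment lam n (Suc k) + gegenbauer_moment_pred lam n k"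
proof -
  have e: "(1 - x\<^sup>2) powr (lam - 1/2) * (2 * x * gegenbauer n lam x * chebU k x) =
    (1 - x\<^sup>2) powr (lam - 1/2) * (gegenbauer n lam x * chebU (Suc k) x) + (1 - x\<^sup>2) powr (lam - 1/2) * (gegenbauer n lam x * chebU_pred k x)" for x
  proof -
    have "(1 - x\<^sup>2) powr (lam - 1/2) * (2 * x * gegenbauer n lam x * chebU k x) =
      (1 - x\<^sup>2) powr (lam - 1/2) * gegenbauer n lam x * (2 * x * chebU k x)" by simp
    thus ?thesis unfolding two_x_chebU by (simp only: distrib_left mult.assoc)
  qed
  show ?thesis unfolding e gegenbauer_moment_def gegenbauer_moment_pred_def
    by (rule integral_add) (intro weight_integrable lam continuous_intros continuous_on_chebU continuous_on_chebU_pred)+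
qed

lemma gegenbauer_moment_1:
  assumes lam: "lam > -1/2"
  shows "gegenbauer_moment lam 1 k = lam * (gegenbauer_moment lam 0 (Suc k) + gegenbauer_moment_pred lam 0 k)"
  unfolding moment_sum[OF lam, symmetric] unfolding gegenbauer_moment_def integral_mult_right[symmetric] gegenbauer_1
  by (simp add: algebra_simps)

lemma gegenbauer_moment_rec:
  assumes lam: "lam > -1/2"
  shows "(real n + 2) * gegenbauer_moment lam (n + 2) k =
     (real n + 1 + lam) * (gegenbauer_moment lam (n + 1) (Suc k) + gegenbauer_moment_pred lam (n + 1) k) - (real n + 2 * lam) * gegenbauer_moment lam n k"
proof -
  let ?w = "\<lambda>x::real. (1 - x\<^sup>2) powr (lam - 1/2)"
  have e: "(real n + 2) * (?w x * (gegenbauer (n + 2) lam x * chebU k x)) =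
      (real n + 1 + lam) * (?w x * (2 * x * gegenbauer (n + 1) lam x * chebU k x)) - (real n + 2 * lam) * (?w x * (gegenbauer n lam x * chebU k x))" for x
  proof -
    have "(real n + 2) * (?w x * (gegenbauer (n + 2) lam x * chebU k x)) = ?w x * chebU k x * ((real n + 2) * gegenbauer (n + 2) lam x)"
      by simp
    also have "\<dots> = ?w x * chebU k x * ((real n + 1 + lam) * (2 * x) * gegenbauer (n + 1) lam x - (real n + 2 * lam) * gegenbauer n lam x)"
      by (simp only: gegenbauer_rec)
    finally show ?thesis by (simp add: algebra_simps)
  qed
  show ?thesis
    unfolding moment_sum[OF lam, symmetric] unfolding gegenbauer_moment_def integral_mult_right[symmetric] e
    by (rule integral_diff) (intro integrable_on_mult_right weight_integrable lam continuous_intros continuous_on_chebU)+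
qed

text \<open>Once the common Gamma factor is removed, this is an identity between rational functions
  of n, j and lam.\<close>

lemma moment_closed_rec:
  assumes lam: "lam > -1/2" "lam \<noteq> 0"
  shows "(real n + 2) * moment_closed lam (n + 2) j =
    (real n + 1 + lam) * (moment_closed lam (n + 1) (j + 1) + moment_closed lam (n + 1) j) - (real n + 2 * lam) * moment_closed lam n (j + 1)"
proof -
  define K where "K = 2 powr (1 - 2 * lam) * pi / Gamma lam"
  define g where "g = Gamma (real n + 2 * lam)"
  define H where "H = Gamma (real n + real j + lam + 2)"
  define P where "P = pochhammer (1 - lam) j"
  define F :: real where "F = fact (n + j + 1)"
  define N :: real where "N = fact n"
  define J :: real where "J = fact j"
  have nz: "H > 0" "N > 0" "J > 0" "real n + real j + lam + 2 > 0" unfolding H_def N_def J_def using lam by (auto intro!: Gamma_real_pos)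
  \<comment> \<open>For n = 0 the argument is 2 * lam, possibly negative but in no case a pole; for
    n > 0 it is positive.\<close>
  have G: "Gamma (real n + 2 * lam + 1) = (real n + 2 * lam) * g"
    unfolding g_def using lam by (cases n; intro Gamma_plus1 notin_nonpos_Ints_gt) auto
  have G2: "Gamma (real n + 2 * lam + 2) = (real n + 2 * lam + 1) * ((real n + 2 * lam) * g)"
    unfolding G[symmetric] using lam Gamma_plus1[of "real n + 2 * lam + 1"] by (simp add: notin_nonpos_Ints_gt add.assoc)
  have H1: "Gamma (real n + real j + lam + 3) = (real n + real j + lam + 2) * H"
    unfolding H_def using lam Gamma_plus1[of "real n + real j + lam + 2"] by (simp add: notin_nonpos_Ints_gt add.assoc)
  have 1: "moment_closed lam (n + 2) j = K * ((real n + 2 * lam + 1) * ((real n + 2 * lam) * g)) * ((real n + real j + 2) * F) * P / (((real n + 2) * (real n + 1) * N) * J * ((real n + real j + lam + 2) * H))"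
    unfolding G2[symmetric] H1[symmetric] moment_closed_def by (simp add: K_def P_def F_def N_def J_def algebra_simps)
  have 2: "moment_closed lam (n + 1) (j + 1) = K * ((real n + 2 * lam) * g) * ((real n + real j + 2) * F) * (P * (1 - lam + real j)) / (((real n + 1) * N) * ((real j + 1) * J) * ((real n + real j + lam + 2) * H))"
    unfolding G[symmetric] H1[symmetric] moment_closed_def by (simp add: K_def P_def F_def N_def J_def pochhammer_Suc algebra_simps)
  have 3: "moment_closed lam (n + 1) j = K * ((real n + 2 * lam) * g) * F * P / (((real n + 1) * N) * J * H)"
    unfolding G[symmetric] moment_closed_def by (simp add: K_def P_def F_def N_def J_def H_def algebra_simps)
  have 4: "moment_closed lam n (j + 1) = K * g * F * (P * (1 - lam + real j)) / (N * ((real j + 1) * J) * H)"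
    unfolding moment_closed_def by (simp add: K_def P_def F_def N_def J_def H_def g_def pochhammer_Suc algebra_simps)
  \<comment> \<open>The common factor: each of the four entries is Q times a rational function of a,
    b and lam.\<close>
  define Q where "Q = K * g * F * P / (N * J * H)"
  define a b where "a = real n" and "b = real j"
  have nz': "a + 2 \<noteq> 0" "a + 1 \<noteq> 0" "b + 1 \<noteq> 0" "a + b + lam + 2 \<noteq> 0" using nz by (auto simp: a_def b_def)
  have 5: "moment_closed lam (n + 2) j = Q * ((a + 2 * lam + 1) * (a + 2 * lam) * (a + b + 2) / ((a + 2) * (a + 1) * (a + b + lam + 2)))"
    unfolding 1 Q_def a_def b_def by (simp add: mult_ac)
  have 6: "moment_closed lam (n + 1) (j + 1) = Q * ((a + 2 * lam) * (a + b + 2) * (1 - lam + b) / ((a + 1) * (b + 1) * (a + b + lam + 2)))"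
    unfolding 2 Q_def a_def b_def by (simp add: mult_ac)
  have 7: "moment_closed lam (n + 1) j = Q * ((a + 2 * lam) / (a + 1))"
    unfolding 3 Q_def a_def b_def by (simp add: mult_ac)
  have 8: "moment_closed lam n (j + 1) = Q * ((1 - lam + b) / (b + 1))"
    unfolding 4 Q_def a_def b_def by (simp add: mult_ac)
  have "(a + 2) * ((a + 2 * lam + 1) * (a + 2 * lam) * (a + b + 2) / ((a + 2) * (a + 1) * (a + b + lam + 2))) =
    (a + 1 + lam) * ((a + 2 * lam) * (a + b + 2) * (1 - lam + b) / ((a + 1) * (b + 1) * (a + b + lam + 2)) + (a + 2 * lam) / (a + 1))
      - (a + 2 * lam) * ((1 - lam + b) / (b + 1))"
proof -
  \<comment> \<open>Taking the denominators as variables makes lam, a and b polynomials in s, p and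
    q, so that the identity becomes polynomial after clearing p q s. The factor a + 2 cancels, and a
    + 2 lam is common to all terms.\<close>
  define s where "s = a + b + lam + 2"
  define p where "p = a + 1"
  define q where "q = b + 1"
  have s: "s \<noteq> 0" "p \<noteq> 0" "q \<noteq> 0" using nz' by (auto simp: s_def p_def q_def)
  have l: "lam = s - p - q" "a = p - 1" "b = q - 1" by (auto simp: s_def p_def q_def)
  have "(a + 2 * lam + 1) * (a + b + 2) * q = (a + 1 + lam) * ((a + b + 2) * (1 - lam + b) + q * s) - (1 - lam + b) * (p * s)"
    unfolding l by algebra
  hence e: "(a + 2 * lam + 1) * (a + b + 2) * q / (p * q * s) = ((a + 1 + lam) * ((a + b + 2) * (1 - lam + b) + q * s) - (1 - lam + b) * (p * s)) / (p * q * s)"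
    by simp
  have "(a + 2) * ((a + 2 * lam + 1) * (a + 2 * lam) * (a + b + 2) / ((a + 2) * p * s)) = (a + 2 * lam) * ((a + 2 * lam + 1) * (a + b + 2) * q / (p * q * s))"
    using s nz'(1) by simp
  also have "\<dots> = (a + 2 * lam) * ((a + 1 + lam) * ((a + b + 2) * (1 - lam + b) / (p * q * s) + 1 / p) - (1 - lam + b) / q)"
    unfolding e using s by (simp add: diff_divide_distrib add_divide_distrib distrib_left)
  also have "\<dots> = (a + 1 + lam) * ((a + 2 * lam) * (a + b + 2) * (1 - lam + b) / (p * q * s) + (a + 2 * lam) / p)
      - (a + 2 * lam) * ((1 - lam + b) / q)"
  proof -
    have "c * (k * (X + 1 / p) - Z) = k * (c * X + c / p) - c * Z" for c k X Z
      by (simp add: right_diff_distrib distrib_left)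
    from this[of _ _ "(a + b + 2) * (1 - lam + b) / (p * q * s)"] show ?thesis
      by (simp only: times_divide_eq_right mult.assoc)
  qed
  finally show ?thesis by (simp only: s_def p_def q_def)
qed
  moreover have "m * (Q * x) = k * (Q * y + Q * z) - c * (Q * w)" if "m * x = k * (y + z) - c * w" for m x k y z c w
  proof -
    have "Q * (m * x) = Q * (k * (y + z) - c * w)" using that by simp
    thus ?thesis by (simp only: algebra_simps)
  qed
  ultimately show ?thesis unfolding 5 6 7 8 a_def[symmetric] by blast
qed

lemma moment_closed_1:
  assumes lam: "lam > -1/2" "lam \<noteq> 0"
  shows "moment_closed lam 1 j = lam * (moment_closed lam 0 (j + 1) + moment_closed lam 0 j)"
proof -
  define Q where "Q = 2 powr (1 - 2 * lam) * pi / Gamma lam * Gamma (2 * lam) * pochhammer (1 - lam) j"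
  define H where "H = Gamma (real j + lam + 1)"
  have nz: "H > 0" "real j + lam + 1 > 0" unfolding H_def using lam by (auto intro!: Gamma_real_pos)
  have G: "Gamma (2 * lam + 1) = 2 * lam * Gamma (2 * lam)"
    using lam by (intro Gamma_plus1 notin_nonpos_Ints_gt) auto
  have H1: "Gamma (real j + lam + 2) = (real j + lam + 1) * H"
    unfolding H_def using lam Gamma_plus1[of "real j + lam + 1"] by (simp add: notin_nonpos_Ints_gt add.assoc)
  have 1: "moment_closed lam 1 j = Q * (2 * lam) * (real j + 1) / ((real j + lam + 1) * H)"
    using G H1 by (simp add: moment_closed_def Q_def ac_simps)
  have 2: "moment_closed lam 0 (j + 1) = Q * (1 - lam + real j) / ((real j + lam + 1) * H)"
    using H1 by (simp add: moment_closed_def Q_def pochhammer_Suc ac_simps)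
  have 3: "moment_closed lam 0 j = Q / H"
    by (simp add: moment_closed_def Q_def H_def)
  show ?thesis unfolding 1 2 3 using nz by (simp add: divide_simps) (simp add: algebra_simps)
qed

text \<open>This is why C_(n+2) has zero moment against U_n: at k = n exactly these two terms of the
  moment recurrence meet and cancel.\<close>

lemma moment_closed_diag:
  assumes lam: "lam > -1/2" "lam \<noteq> 0"
  shows "(real n + 1 + lam) * moment_closed lam (n + 1) 0 = (real n + 2 * lam) * moment_closed lam n 0"
proof -
  define g where "g = Gamma (real n + 2 * lam)"
  define H where "H = Gamma (real n + lam + 1)"
  have nz: "H > 0" "real n + 1 + lam > 0" unfolding H_def using lam by (auto intro!: Gamma_real_pos)
  have G: "Gamma (real n + 2 * lam + 1) = (real n + 2 * lam) * g"
    unfolding g_def using lam by (cases n; intro Gamma_plus1 notin_nonpos_Ints_gt) auto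
  have H1: "Gamma (real n + lam + 2) = (real n + 1 + lam) * H"
    unfolding H_def using lam Gamma_plus1[of "real n + lam + 1"] by (simp add: notin_nonpos_Ints_gt ac_simps)
  define K where "K = 2 powr (1 - 2 * lam) * pi / Gamma lam"
  have 1: "moment_closed lam (n + 1) 0 = K * ((real n + 2 * lam) * g) / ((real n + 1 + lam) * H)"
    unfolding G[symmetric] H1[symmetric] by (simp add: moment_closed_def K_def add_ac mult_ac)
  have 2: "moment_closed lam n 0 = K * g / H"
    by (simp add: moment_closed_def K_def g_def H_def)
  show ?thesis using nz unfolding 1 2 by simp
qed

text \<open>The two-index recurrence determines row n + 2 from rows n + 1 and n, so it suffices that
  the table obeys it and is right in rows 0 and 1.\<close>

lemma gegenbauer_moment_eq:
  assumes lam: "lam > -1/2" "lam \<noteq> 0"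
  shows "gegenbauer_moment lam n k = moment_table lam n k"
proof (induction n arbitrary: k rule: induct_nat_012)
  case 0
  show ?case by (rule gegenbauer_moment_0[OF lam])
next
  case 1
  show ?case
  proof (cases "odd k")
    case True
    then obtain j where k: "k = 2 * j + 1" by (elim oddE)
    show ?thesis
      using moment_closed_1[OF lam, of j]
      by (simp add: gegenbauer_moment_1[OF lam(1), unfolded One_nat_def] gegenbauer_moment_pred_eq gegenbauer_moment_0[OF lam] moment_table_def k)
  next
    case False
    thus ?thesis
      by (auto simp: gegenbauer_moment_1[OF lam(1), unfolded One_nat_def] gegenbauer_moment_pred_eq gegenbauer_moment_0[OF lam] moment_table_def split: nat.splits)
  qed
next
  case (ge2 n)
  have r: "(real n + 2) * gegenbauer_moment lam (Suc (Suc n)) k =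
     (real n + 1 + lam) * (moment_table lam (Suc n) (Suc k) + (case k of 0 \<Rightarrow> 0 | Suc k \<Rightarrow> moment_table lam (Suc n) k)) - (real n + 2 * lam) * moment_table lam n k"
    using gegenbauer_moment_rec[OF lam(1), of n k] ge2 by (simp add: gegenbauer_moment_pred_eq cong: nat.case_cong)
  \<comment> \<open>In (a) and (b) every entry of the recurrence vanishes, by parity or by lying
    below the diagonal; k = n + 1 falls under (a).\<close>
  consider (a) "odd (n + k)" | (b) "k < n" | (c) "k = n" | (d) j where "k = n + 2 + 2 * j"
  proof -
    have "\<exists>j. k = n + 2 + 2 * j" if "even (n + k)" "n < k"
    proof -
      from that have "even (k - n)" "k - n > 0" by auto
      then obtain i where "k - n = 2 * i" "i > 0" by (elim evenE) auto
      hence "k = n + 2 + 2 * (i - 1)" using that by (cases i) auto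
      thus ?thesis by blast
    qed
    thus ?thesis using that by (metis linorder_neqE_nat)
  qed
  hence "(real n + 2) * gegenbauer_moment lam (Suc (Suc n)) k = (real n + 2) * moment_table lam (Suc (Suc n)) k"
  proof cases
    case a
    thus ?thesis unfolding r by (auto simp: moment_table_def split: nat.splits)
  next
    case b
    thus ?thesis unfolding r by (auto simp: moment_table_def split: nat.splits)
  next
    case c
    thus ?thesis unfolding r using moment_closed_diag[OF lam, of n] by (auto simp: moment_table_def split: nat.splits)
  next
    case (d j)
    have "moment_table lam (Suc n) (Suc k) = moment_closed lam (n + 1) (j + 1)" by (simp add: moment_table_def d)
    moreover have "(case k of 0 \<Rightarrow> 0 | Suc k \<Rightarrow> moment_table lam (Suc n) k) = moment_closed lam (n + 1) j" by (simp add: moment_table_def d)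
    moreover have "moment_table lam n k = moment_closed lam n (j + 1)" by (simp add: moment_table_def d)
    moreover have "moment_table lam (Suc (Suc n)) k = moment_closed lam (n + 2) j" by (simp add: moment_table_def d)
    ultimately show ?thesis unfolding r using moment_closed_rec[OF lam, of n j] by simp
  qed
  thus ?case by simp
qed

section \<open>The hypergeometric series\<close>

definition hyp_coeff :: "real \<Rightarrow> real \<Rightarrow> real \<Rightarrow> nat \<Rightarrow> real" where
  "hyp_coeff a b c j = pochhammer a j * pochhammer b j / (pochhammer c j * fact j)"

lemma hyp2f1_eq: "hyp2f1 a b c z = (\<Sum>j. hyp_coeff a b c j * z ^ j)"
  by (simp add: hyp2f1_def hyp_coeff_def)

lemma hyp_coeff_Suc:
  "hyp_coeff a b c (Suc j) = hyp_coeff a b c j * ((a + real j) / (c + real j) * ((b + real j) / (1 + real j)))"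
  by (simp add: hyp_coeff_def pochhammer_Suc mult_ac)

lemma tendsto_ratio_1: "(\<lambda>j. (a + real j) / (b + real j)) \<longlonglongrightarrow> 1"
proof -
  have lim: "filterlim (\<lambda>j. b + real j) at_top sequentially"
    by (intro filterlim_tendsto_add_at_top[OF tendsto_const] filterlim_real_sequentially)
  have "(\<lambda>j. 1 + (a - b) / (b + real j)) \<longlonglongrightarrow> 1 + 0"
    by (intro tendsto_add tendsto_const real_tendsto_divide_at_top[OF tendsto_const lim])
  moreover have "eventually (\<lambda>j. 1 + (a - b) / (b + real j) = (a + real j) / (b + real j)) sequentially"
    using lim[unfolded filterlim_at_top_dense, rule_format, of 0]
    by eventually_elim (simp add: field_simps)
  ultimately show ?thesis using tendsto_cong by fastforce
qed

text \<open>The term ratio tends to r < 1. It is used as a multiplier, from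
  \<open>hyp_coeff_Suc\<close>, and not as a quotient of terms, so terminating series are covered as
  well.\<close>

lemma summable_hyp_coeff:
  assumes r: "0 \<le> r" "r < 1"
  shows "summable (\<lambda>j. \<bar>hyp_coeff a b c j\<bar> * r ^ j)"
proof -
  let ?q = "\<lambda>j. \<bar>(a + real j) / (c + real j) * ((b + real j) / (1 + real j))\<bar> * r"
  have "?q \<longlonglongrightarrow> \<bar>1 * 1\<bar> * r"
    by (intro tendsto_intros tendsto_ratio_1)
  moreover obtain s where s: "r < s" "s < 1" using r dense by blast
  ultimately have "eventually (\<lambda>j. ?q j < s) sequentially"
    by (intro order_tendstoD) auto
  then obtain N where N: "\<And>j. j \<ge> N \<Longrightarrow> ?q j < s" by (auto simp: eventually_at_top_linorder)
  show ?thesis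
  proof (rule summable_ratio_test[of s N])
    fix j assume "j \<ge> N"
    hence "\<bar>hyp_coeff a b c j\<bar> * r ^ j * ?q j \<le> \<bar>hyp_coeff a b c j\<bar> * r ^ j * s"
      using N[of j] r by (intro mult_left_mono) auto
    thus "norm (\<bar>hyp_coeff a b c (Suc j)\<bar> * r ^ Suc j) \<le> s * norm (\<bar>hyp_coeff a b c j\<bar> * r ^ j)"
      using r by (simp add: hyp_coeff_Suc abs_mult mult_ac)
  qed (use s in auto)
qed

lemma summable_hyp_coeff_complex:
  assumes "norm z < 1"
  shows "summable (\<lambda>j. complex_of_real (hyp_coeff a b c j) * z ^ j)"
  by (rule summable_norm_cancel) (use summable_hyp_coeff[of "norm z"] assms in \<open>simp add: norm_mult norm_power\<close>)

section \<open>Euler's integral and estimates of 2F1\<close>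

lemma binomial_sums_complex:
  assumes "norm z < 1"
  shows "(\<lambda>j. complex_of_real (hyp_coeff 1 b 1 j) * z ^ j) sums ((1 - z) powr (- of_real b))"
proof -
  \<comment> \<open>The two factors (1)_j cancel in \<open>hyp_coeff 1 b 1 j\<close>, leaving (b)_j
    / j!, the binomial coefficient of (1 - z)^(-b).\<close>
  have c: "(- of_real b gchoose j) * (- z) ^ j = complex_of_real (hyp_coeff 1 b 1 j) * z ^ j" for j
  proof -
    have "(- of_real b gchoose j) * (- z) ^ j = ((- 1) ^ j * (- z) ^ j) * (pochhammer (of_real b) j / fact j)"
      by (simp add: gbinomial_pochhammer)
    also have "(- 1) ^ j * (- z) ^ j = z ^ j" by (simp flip: power_mult_distrib)
    also have "complex_of_real (hyp_coeff 1 b 1 j) = pochhammer (of_real b) j / fact j"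
      by (simp add: hyp_coeff_def pochhammer_fact[symmetric] pochhammer_of_real)
    ultimately show ?thesis by (simp add: mult_ac)
  qed
  show ?thesis
    using gen_binomial_complex[of "-z" "- of_real b"] assms unfolding c by simp
qed

lemma beta_moment:
  fixes lam :: real
  assumes "lam > 0"
  shows "((\<lambda>t. t powr real n * (1 - t) powr (lam - 1) * t ^ j) has_integral Beta (real n + 1 + real j) lam) {0..1}"
proof -
  have "((\<lambda>t. t powr (real n + 1 + real j - 1) * (1 - t) powr (lam - 1)) has_integral Beta (real n + 1 + real j) lam) {0..1}"
    by (rule has_integral_Beta_real) (use assms in auto)
  also have "?this \<longleftrightarrow> ?thesis"
  proof (rule has_integral_cong)
    fix t :: real assume t: "t \<in> {0..1}"
    show "t powr (real n + 1 + real j - 1) * (1 - t) powr (lam - 1) = t powr real n * (1 - t) powr (lam - 1) * t ^ j"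
    \<comment> \<open>At t = 0 both sides are 0, even for n = 0, because
      \<open>0 powr 0 = 0\<close>.\<close>
    proof (cases "t = 0")
      case False
      hence "t powr (real n + real j) = t powr real n * t ^ j"
        using t by (simp add: powr_add powr_realpow)
      thus ?thesis by (simp add: mult_ac)
    qed auto
  qed
  finally show ?thesis .
qed

text \<open>For a = n + 1 and b = lam the quotient is exactly what turns a binomial coefficient into
  a coefficient of 2F1.\<close>

lemma Beta_shift:
  fixes a b :: real
  assumes "a > 0" "b > 0"
  shows "Beta (a + real j) b = Beta a b * (pochhammer a j / pochhammer (a + b) j)"
proof -
  have "a \<notin> \<int>\<^sub>\<le>\<^sub>0" "a + b \<notin> \<int>\<^sub>\<le>\<^sub>0" using assms by (intro notin_nonpos_Ints_gt; simp)+
  moreover have "Gamma a > 0" "Gamma (a + b) > 0" "Gamma (a + b + real j) > 0" using assms by (auto intro!: Gamma_real_pos add_pos_nonneg)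
  ultimately show ?thesis by (simp add: Beta_def pochhammer_Gamma add_ac)
qed

text \<open>The binomial series of (1 - z t)^(lam - 1) is integrated against a Beta weight. Of the
  two numerator parameters, n + 1 goes into the weight and 1 - lam into the power, which makes the
  weight integrable for every lam > 0.\<close>

lemma euler_integral:
  fixes lam :: real
  assumes lam: "lam > 0" and z: "norm z < 1"
  shows "((\<lambda>t. complex_of_real (t powr real n * (1 - t) powr (lam - 1)) * (1 - z * of_real t) powr of_real (lam - 1))
     has_integral of_real (Beta (real n + 1) lam) * (\<Sum>j. of_real (hyp_coeff (real n + 1) (1 - lam) (real n + lam + 1) j) * z ^ j)) {0..1}"
proof -
  define w where "w = (\<lambda>t::real. t powr real n * (1 - t) powr (lam - 1))"
  define b where "b = hyp_coeff 1 (1 - lam) 1"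
  define g where "g = (\<lambda>j t. complex_of_real (w t * t ^ j) * (of_real (b j) * z ^ j))"
  have m: "((\<lambda>t. w t * t ^ j) has_integral Beta (real n + 1 + real j) lam) {0..1}" for j
    unfolding w_def by (rule beta_moment[OF lam])
  have g: "(g j has_integral of_real (Beta (real n + 1 + real j) lam) * (of_real (b j) * z ^ j)) {0..1}" for j
    unfolding g_def by (intro has_integral_mult_left has_integral_of_real m)
  have w: "w integrable_on {0..1}" using m[of 0] by (simp add: has_integral_integrable_integral)
  have w0: "w t \<ge> 0" for t by (simp add: w_def)
  have le: "norm (g j t) \<le> (\<bar>b j\<bar> * norm z ^ j) * w t" if "t \<in> {0..1}" for j t
  proof -
    have "norm (g j t) = (\<bar>b j\<bar> * norm z ^ j) * w t * t ^ j"
      using that w0[of t] by (simp add: g_def norm_mult norm_power abs_mult mult_ac)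
    also have "\<dots> \<le> (\<bar>b j\<bar> * norm z ^ j) * w t * 1"
      using that w0[of t] by (intro mult_left_mono) (auto intro: power_le_one)
    finally show ?thesis by simp
  qed
  have s: "summable (\<lambda>j. \<bar>b j\<bar> * norm z ^ j)" unfolding b_def by (rule summable_hyp_coeff) (use z in auto)
  have int: "(\<lambda>t. \<Sum>j. g j t) integrable_on {0..1}" "(\<lambda>j. integral {0..1} (g j)) sums integral {0..1} (\<lambda>t. \<Sum>j. g j t)"
    by (rule integral_sums_dominated[OF has_integral_integrable[OF g] w s _ _ le]; simp add: w0)+
  have "((\<lambda>t. \<Sum>j. g j t) has_integral integral {0..1} (\<lambda>t. \<Sum>j. g j t)) {0..1}"
    using int(1) by (simp add: integrable_integral)
  also have "integral {0..1} (\<lambda>t. \<Sum>j. g j t) = of_real (Beta (real n + 1) lam) * (\<Sum>j. of_real (hyp_coeff (real n + 1) (1 - lam) (real n + lam + 1) j) * z ^ j)"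
  proof -
    have "integral {0..1} (g j) = of_real (Beta (real n + 1) lam) * (of_real (hyp_coeff (real n + 1) (1 - lam) (real n + lam + 1) j) * z ^ j)" for j
    proof -
      have "Beta (real n + 1 + real j) lam * b j = Beta (real n + 1) lam * hyp_coeff (real n + 1) (1 - lam) (real n + lam + 1) j"
        using Beta_shift[of "real n + 1" lam j] lam
        by (simp add: b_def hyp_coeff_def pochhammer_fact[symmetric] ac_simps)
      hence "complex_of_real (Beta (real n + 1 + real j) lam) * of_real (b j) = of_real (Beta (real n + 1) lam) * of_real (hyp_coeff (real n + 1) (1 - lam) (real n + lam + 1) j)"
        unfolding of_real_mult[symmetric] by simp
      thus ?thesis unfolding integral_unique[OF g] mult.assoc[symmetric] by simp
    qed
    hence "(\<lambda>j. integral {0..1} (g j)) sums (of_real (Beta (real n + 1) lam) * (\<Sum>j. of_real (hyp_coeff (real n + 1) (1 - lam) (real n + lam + 1) j) * z ^ j))"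
      by (simp only:) (intro sums_mult summable_sums summable_hyp_coeff_complex z)
    thus ?thesis using int(2) sums_unique2 by blast
  qed
  also have "((\<lambda>t. \<Sum>j. g j t) has_integral X) {0..1} \<longleftrightarrow> ((\<lambda>t. complex_of_real (w t) * (1 - z * of_real t) powr of_real (lam - 1)) has_integral X) {0..1}" for X
  proof (rule has_integral_cong)
    fix t :: real assume t: "t \<in> {0..1}"
    have "norm (z * of_real t) < 1" using t z by (simp add: norm_mult mult_less_le_imp_less mult_le_one order.strict_trans1[OF mult_left_le])
    from sums_mult[OF binomial_sums_complex[OF this, of "1 - lam"], of "of_real (w t)"]
    have "(\<lambda>j. g j t) sums (of_real (w t) * (1 - z * of_real t) powr (- of_real (1 - lam)))"
      by (simp add: g_def b_def power_mult_distrib mult_ac)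
    thus "(\<Sum>j. g j t) = complex_of_real (w t) * (1 - z * of_real t) powr of_real (lam - 1)"
      by (simp add: sums_iff)
  qed
  finally show ?thesis unfolding w_def .
qed

text \<open>Under Euler's integral |1 - z t| <= 1 + |z| t, with equality at z = -|z|, and raising to
  the positive power lam - 1 preserves the inequality. The positive Beta factor then
  cancels.\<close>

lemma norm_hyp_series_le_gt_1:
  assumes lam: "lam > 1" and z: "norm z < 1"
  shows "norm (\<Sum>j. complex_of_real (hyp_coeff (real n + 1) (1 - lam) (real n + lam + 1) j) * z ^ j)
       \<le> hyp2f1 (real n + 1) (1 - lam) (real n + lam + 1) (- norm z)"
proof -
  define w where "w = (\<lambda>t::real. t powr real n * (1 - t) powr (lam - 1))"
  define r where "r = norm z"
  define F where "F = (\<lambda>z. \<Sum>j. complex_of_real (hyp_coeff (real n + 1) (1 - lam) (real n + lam + 1) j) * z ^ j)"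
  define h where "h = (\<lambda>z t. complex_of_real (w t) * (1 - z * of_real t) powr of_real (lam - 1))"
  define B where "B = Beta (real n + 1) lam"
  have B: "B > 0" unfolding B_def Beta_def using lam by (auto intro!: mult_pos_pos divide_pos_pos Gamma_real_pos)
  have e: "(h z has_integral of_real B * F z) {0..1}" if "norm z < 1" for z
    using euler_integral[of lam z n] lam that unfolding h_def w_def F_def B_def by simp
  have F: "F (of_real (-r)) = of_real (hyp2f1 (real n + 1) (1 - lam) (real n + lam + 1) (- r))"
  proof -
    have "summable (\<lambda>j. hyp_coeff (real n + 1) (1 - lam) (real n + lam + 1) j * (-r) ^ j)"
      by (rule summable_norm_cancel)
         (use summable_hyp_coeff[of r "real n + 1" "1 - lam" "real n + lam + 1"] z in \<open>simp add: abs_mult power_abs r_def\<close>)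
    thus ?thesis unfolding F_def hyp2f1_eq suminf_of_real[OF \<open>summable _\<close>] by (simp only: of_real_mult of_real_power)
  qed
  have e2: "(h (of_real (-r)) has_integral of_real B * F (of_real (-r))) {0..1}"
    by (rule e) (use z in \<open>simp add: r_def\<close>)
  have e3: "((\<lambda>t. Re (h (of_real (-r)) t)) has_integral B * hyp2f1 (real n + 1) (1 - lam) (real n + lam + 1) (- r)) {0..1}"
    using has_integral_linear[OF e2[unfolded F] bounded_linear_Re] by (simp add: o_def)
  have "norm (of_real B * F z) \<le> B * hyp2f1 (real n + 1) (1 - lam) (real n + lam + 1) (- r)"
    unfolding integral_unique[OF e[OF z], symmetric] integral_unique[OF e3, symmetric]
  proof (rule integral_norm_bound_integral)
    show "h z integrable_on {0..1}" using e[OF z] by blast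
    show "(\<lambda>t. Re (h (of_real (-r)) t)) integrable_on {0..1}" using e3 by blast
    fix t :: real assume t: "t \<in> {0..1}"
    have w0: "w t \<ge> 0" by (simp add: w_def)
    have r0: "1 + r * t \<ge> 0" using t by (simp add: r_def)
    have "norm (1 - z * of_real t) \<le> norm (1::complex) + norm (z * of_real t)" by (rule norm_triangle_ineq4)
    also have "\<dots> = 1 + r * t" using t by (simp add: norm_mult r_def)
    finally have n: "norm (1 - z * of_real t) \<le> 1 + r * t" .
    have "norm (h z t) = w t * norm (1 - z * of_real t) powr (lam - 1)"
      using w0 by (simp add: h_def norm_mult norm_powr_real_powr')
    also have "\<dots> \<le> w t * (1 + r * t) powr (lam - 1)"
      using w0 n lam by (intro mult_left_mono powr_mono2) auto
    also have "\<dots> = Re (h (of_real (-r)) t)"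
    proof -
      have "1 - complex_of_real (-r) * of_real t = of_real (1 + r * t)" by simp
      hence "h (of_real (-r)) t = of_real (w t * (1 + r * t) powr (lam - 1))"
        unfolding h_def using powr_of_real[OF r0, of "lam - 1"] by (simp only: of_real_mult)
      thus ?thesis by simp
    qed
    finally show "norm (h z t) \<le> Re (h (of_real (-r)) t)" .
  qed
  thus ?thesis using B by (simp add: norm_mult F_def r_def)
qed

lemma pochhammer_nonneg': "x \<ge> 0 \<Longrightarrow> pochhammer (x::real) j \<ge> 0"
  by (cases "x = 0") (auto simp: pochhammer_0_left pochhammer_nonneg)

lemma norm_hyp_series_le_le_1:
  assumes lam: "lam > -1/2" "lam \<le> 1" and z: "norm z < 1"
  shows "norm (\<Sum>j. complex_of_real (hyp_coeff (real n + 1) (1 - lam) (real n + lam + 1) j) * z ^ j)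
       \<le> hyp2f1 (real n + 1) (1 - lam) (real n + lam + 1) (norm z)"
proof -
  have nn: "hyp_coeff (real n + 1) (1 - lam) (real n + lam + 1) j \<ge> 0" for j
    unfolding hyp_coeff_def using lam
    by (intro divide_nonneg_nonneg mult_nonneg_nonneg pochhammer_nonneg') auto
  hence "norm (complex_of_real (hyp_coeff (real n + 1) (1 - lam) (real n + lam + 1) j) * z ^ j) = hyp_coeff (real n + 1) (1 - lam) (real n + lam + 1) j * norm z ^ j" for j
    by (simp add: norm_mult norm_power)
  moreover have "summable (\<lambda>j. hyp_coeff (real n + 1) (1 - lam) (real n + lam + 1) j * norm z ^ j)"
    using summable_hyp_coeff[of "norm z" "real n + 1" "1 - lam" "real n + lam + 1"] z nn by simp
  ultimately show ?thesis
    using summable_norm[of "\<lambda>j. complex_of_real (hyp_coeff (real n + 1) (1 - lam) (real n + lam + 1) j) * z ^ j"]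
    by (simp only: hyp2f1_eq)
qed

text \<open>The ratio of consecutive terms is at most 2 * (1 + |lam|) * |x| <= 1/2, uniformly in n:
  its first quotient is at most 2 because lam > -1/2, its second at most 1 + |lam|. The comparison
  series is geometric with sum 2.\<close>

lemma abs_hyp2f1_le_2:
  assumes lam: "lam > -1/2" and r: "\<bar>x\<bar> * (4 * (1 + \<bar>lam\<bar>)) \<le> 1"
  shows "\<bar>hyp2f1 (real n + 1) (1 - lam) (real n + lam + 1) x\<bar> \<le> 2"
proof -
  let ?c = "hyp_coeff (real n + 1) (1 - lam) (real n + lam + 1)"
  have le: "norm (?c j * x ^ j) \<le> (1 / 2) ^ j" for j
  proof (induction j)
    case (Suc j)
    have 1: "\<bar>(real n + 1 + real j) / (real n + lam + 1 + real j)\<bar> \<le> 2"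
      using lam by (simp add: abs_of_pos divide_le_eq abs_divide)
    have 2: "\<bar>(1 - lam + real j) / (1 + real j)\<bar> \<le> 1 + \<bar>lam\<bar>"
    proof -
      have "\<bar>1 - lam + real j\<bar> \<le> 1 + real j + \<bar>lam\<bar>" by linarith
      also have "\<dots> \<le> (1 + \<bar>lam\<bar>) * (1 + real j)" by (simp add: algebra_simps)
      finally show ?thesis by (simp add: abs_divide divide_le_eq)
    qed
    have "\<bar>(real n + 1 + real j) / (real n + lam + 1 + real j) * ((1 - lam + real j) / (1 + real j)) * x\<bar> \<le> 2 * (1 + \<bar>lam\<bar>) * \<bar>x\<bar>"
      unfolding abs_mult using 1 2 by (intro mult_mono) auto
    also have "\<dots> \<le> 1 / 2" using r by (simp add: algebra_simps)
    finally have "norm (?c j * x ^ j) * \<bar>(real n + 1 + real j) / (real n + lam + 1 + real j) * ((1 - lam + real j) / (1 + real j)) * x\<bar> \<le> (1 / 2) ^ j * (1 / 2)"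
      by (intro mult_mono Suc) auto
    thus ?case unfolding hyp_coeff_Suc by (simp add: abs_mult mult_ac)
  qed (simp add: hyp_coeff_def)
  have "norm (suminf (\<lambda>j. ?c j * x ^ j)) \<le> suminf (\<lambda>j. (1/2 :: real) ^ j)"
    by (rule norm_suminf_le[OF le]) auto
  also have "\<dots> = 2" by (simp add: suminf_geometric)
  finally show ?thesis by (simp add: hyp2f1_eq)
qed

section \<open>Gegenbauer coefficients\<close>

lemma Gamma_args_notin_nonpos_Ints:
  fixes lam :: real
  assumes "lam > -1/2" "lam \<noteq> 0"
  shows "lam \<notin> \<int>\<^sub>\<le>\<^sub>0" "real n + lam \<notin> \<int>\<^sub>\<le>\<^sub>0" "real n + 2 * lam \<notin> \<int>\<^sub>\<le>\<^sub>0" "real n + lam + 1 \<notin> \<int>\<^sub>\<le>\<^sub>0"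
  using assms by (cases n; intro notin_nonpos_Ints_gt; simp)+

lemma gegenbauer_h_nz: "lam > -1/2 \<Longrightarrow> lam \<noteq> 0 \<Longrightarrow> gegenbauer_h n lam \<noteq> 0"
  using Gamma_args_notin_nonpos_Ints(1)[of lam] Gamma_args_notin_nonpos_Ints(2-4)[of lam n] Gamma_real_pos[of "real n + 1"]
  by (cases n) (auto simp: gegenbauer_h_def Gamma_eq_zero_iff)

lemma c_const_nz: "lam > -1/2 \<Longrightarrow> lam \<noteq> 0 \<Longrightarrow> c_const n lam \<noteq> 0"
  using Gamma_args_notin_nonpos_Ints(1)[of lam] Gamma_args_notin_nonpos_Ints(2-4)[of lam n] Gamma_real_pos[of "real n + 1"]
  by (auto simp: c_const_def Gamma_eq_zero_iff)

lemma c_const_pos: "lam > 0 \<Longrightarrow> c_const n lam > 0"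
  unfolding c_const_def by (intro divide_pos_pos mult_pos_pos Gamma_real_pos) auto

text \<open>Splitting Gamma (n + j + lam + 1) as (n + lam) * Gamma (n + lam) * (n + lam + 1)_j
  brings out the denominators of h_n, c_n and 2F1.\<close>

lemma moment_closed_eq:
  assumes lam: "lam > -1/2" "lam \<noteq> 0"
  shows "moment_closed lam n j = gegenbauer_h n lam * (c_const n lam * hyp_coeff (real n + 1) (1 - lam) (real n + lam + 1) j)"
proof -
  note nn = Gamma_args_notin_nonpos_Ints(1)[OF lam] Gamma_args_notin_nonpos_Ints(2-4)[OF lam, of n]
  have nz: "Gamma lam \<noteq> 0" "Gamma (real n + lam) \<noteq> 0" "Gamma (real n + lam + 1) \<noteq> 0" "real n + lam \<noteq> 0"
    using nn by (auto simp: Gamma_eq_zero_iff)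
  have G: "Gamma (real n + lam + 1) = (real n + lam) * Gamma (real n + lam)"
    by (rule Gamma_plus1) (rule nn)
  have n1: "real n + 1 \<notin> \<int>\<^sub>\<le>\<^sub>0" by (intro notin_nonpos_Ints_gt) auto
  have F: "Gamma (real n + 1) = fact n" "Gamma (real n + 1 + real j) = fact (n + j)"
    using Gamma_fact[of n, where 'a=real] Gamma_fact[of "n + j", where 'a=real] by (simp_all add: add_ac)
  have p: "pochhammer (real n + 1) j = fact (n + j) / fact n"
    unfolding pochhammer_Gamma[OF n1] F ..
  have q: "pochhammer (real n + lam + 1) j = Gamma (real n + real j + lam + 1) / ((real n + lam) * Gamma (real n + lam))"
    unfolding pochhammer_Gamma[OF nn(4)] G[symmetric] by (simp add: add_ac)
  show ?thesis
    unfolding moment_closed_def gegenbauer_h_def c_const_def hyp_coeff_def p q F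
    using nz by (simp add: power2_eq_square mult_ac)
qed

text \<open>The expansion in U_k is integrated term by term: the decay rho^(-k-1) of the
  coefficients beats |U_k| <= k + 1, and the weight times |C_n| stays as the integrable
  majorant.\<close>

lemma gegenbauer_coeff_sums:
  assumes lam: "lam > -1/2" "lam \<noteq> 0" and rho: "rho > 1" and f: "f analytic_on bernstein_region rho"
  shows "(\<lambda>j. ellipse_coeff rho f (n + 2 * j) * of_real (c_const n lam * hyp_coeff (real n + 1) (1 - lam) (real n + lam + 1) j))
     sums gegenbauer_coeff lam f n"
proof -
  have cont: "continuous_on (bernstein_ellipse rho) f"
    using analytic_imp_holomorphic[OF f] holomorphic_on_imp_continuous_on continuous_on_subset bernstein_ellipse_subset[OF rho] by blast
  obtain B where B: "B \<ge> 0" "\<And>k. norm (ellipse_coeff rho f k) \<le> B * inverse rho ^ (k + 1)"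
    using norm_ellipse_coeff_le[OF rho cont] by blast
  let ?w = "\<lambda>x::real. (1 - x\<^sup>2) powr (lam - 1/2)"
  define g where "g = (\<lambda>k x. ellipse_coeff rho f k * complex_of_real (?w x * (gegenbauer n lam x * chebU k x)))"
  have hi: "(\<lambda>x. ?w x * (gegenbauer n lam x * chebU k x)) integrable_on {-1..1}" for k
    by (intro weight_integrable lam continuous_intros continuous_on_chebU)
  have g: "(g k has_integral ellipse_coeff rho f k * of_real (gegenbauer_moment lam n k)) {-1..1}" for k
    unfolding g_def gegenbauer_moment_def by (intro has_integral_mult_right has_integral_of_real integrable_integral hi)
  have "(\<lambda>k. integral {-1..1} (g k)) sums integral {-1..1} (\<lambda>x. \<Sum>k. g k x)"
  proof (rule integral_sums_dominated(2))
    show "g k integrable_on {-1..1}" for k using g by blast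
    show "(\<lambda>x. ?w x * \<bar>gegenbauer n lam x\<bar>) integrable_on {-1..1}"
      by (intro weight_integrable lam continuous_intros)
    show "summable (\<lambda>k. B * ((real k + 1) * inverse rho ^ (k + 1)))"
      using rho by (intro summable_mult summable_Suc_times_power) (auto simp: inverse_less_1_iff)
    show "B * ((real k + 1) * inverse rho ^ (k + 1)) \<ge> 0" for k using rho B by simp
    show "norm (g k x) \<le> B * ((real k + 1) * inverse rho ^ (k + 1)) * (?w x * \<bar>gegenbauer n lam x\<bar>)" if "x \<in> {-1..1}" for k x
    proof -
      have "norm (g k x) = norm (ellipse_coeff rho f k) * \<bar>chebU k x\<bar> * (?w x * \<bar>gegenbauer n lam x\<bar>)"
        by (simp add: g_def norm_mult abs_mult)
      also have "\<dots> \<le> (B * inverse rho ^ (k + 1)) * (real k + 1) * (?w x * \<bar>gegenbauer n lam x\<bar>)"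
        using B abs_chebU_le[OF that, of k] rho by (intro mult_right_mono mult_mono) auto
      finally show ?thesis by (simp only: mult_ac)
    qed
  qed auto
  also have "integral {-1..1} (\<lambda>x. \<Sum>k. g k x) = integral {-1..1} (\<lambda>x. complex_of_real (?w x * gegenbauer n lam x) * f (of_real x))"
  proof (rule integral_cong)
    fix x :: real assume x: "x \<in> {-1..1}"
    have "(\<lambda>k. complex_of_real (?w x * gegenbauer n lam x) * (ellipse_coeff rho f k * of_real (chebU k x))) sums
       (complex_of_real (?w x * gegenbauer n lam x) * f (of_real x))"
      by (intro sums_mult cheb_expansion rho f x)
    also have "(\<lambda>k. complex_of_real (?w x * gegenbauer n lam x) * (ellipse_coeff rho f k * of_real (chebU k x))) = (\<lambda>k. g k x)"
      by (simp add: g_def mult_ac)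
    finally show "(\<Sum>k. g k x) = complex_of_real (?w x * gegenbauer n lam x) * f (of_real x)"
      by (simp add: sums_iff)
  qed
  finally have "(\<lambda>k. complex_of_real (1 / gegenbauer_h n lam) * (ellipse_coeff rho f k * of_real (moment_table lam n k))) sums gegenbauer_coeff lam f n"
    unfolding integral_unique[OF g] gegenbauer_moment_eq[OF lam] gegenbauer_coeff_def by (rule sums_mult)
  hence "(\<lambda>j. complex_of_real (1 / gegenbauer_h n lam) * (ellipse_coeff rho f (n + 2 * j) * of_real (moment_table lam n (n + 2 * j)))) sums gegenbauer_coeff lam f n"
  \<comment> \<open>Only the indices k = n + 2 j can carry a nonzero moment.\<close>
  proof (subst sums_mono_reindex[where g = "\<lambda>j. n + 2 * j"])
    show "strict_mono (\<lambda>j. n + 2 * j)" by (simp add: strict_mono_def)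
    show "complex_of_real (1 / gegenbauer_h n lam) * (ellipse_coeff rho f k * of_real (moment_table lam n k)) = 0"
      if "k \<notin> range (\<lambda>j. n + 2 * j)" for k
    proof -
      have "\<not> (n \<le> k \<and> even (k - n))"
      proof
        assume "n \<le> k \<and> even (k - n)"
        then obtain j where "k = n + 2 * j" by (metis evenE le_add_diff_inverse)
        thus False using that by blast
      qed
      hence "moment_table lam n k = 0" unfolding moment_table_def by (rule if_not_P)
      thus ?thesis by simp
    qed
  qed
  thus ?thesis
    unfolding moment_table_diag moment_closed_eq[OF lam] using gegenbauer_h_nz[OF lam, of n] by simp
qed

text \<open>Resummation: u^(-(n+2j)-1) = u^(-n-1) * (u^(-2))^j puts the series over j back under one
  integral. Moduli are taken only afterwards, since bounding the terms one by one would lose the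
  sign structure that matters for lam > 1.\<close>

lemma gegenbauer_coeff_integral:
  fixes n :: nat
  assumes lam: "lam > -1/2" "lam \<noteq> 0" and rho: "rho > 1" and f: "f analytic_on bernstein_region rho"
  defines "G \<equiv> \<lambda>t. f (bernstein_param rho t) * ellipse_deriv rho t * inverse (ellipse_u rho t) ^ (n + 1)
       * (\<Sum>j. complex_of_real (hyp_coeff (real n + 1) (1 - lam) (real n + lam + 1) j) * (inverse (ellipse_u rho t) ^ 2) ^ j)"
  shows "G integrable_on {0..2*pi}"
    and "gegenbauer_coeff lam f n = of_real (c_const n lam) / (of_real pi * \<i>) * integral {0..2*pi} G"
proof -
  have cont: "continuous_on (bernstein_ellipse rho) f"
    using analytic_imp_holomorphic[OF f] holomorphic_on_imp_continuous_on continuous_on_subset bernstein_ellipse_subset[OF rho] by blast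
  obtain B where B: "B \<ge> 0" "\<And>t. t \<in> {0..2*pi} \<Longrightarrow> norm (f (bernstein_param rho t) * ellipse_deriv rho t) \<le> B"
    "continuous_on {0..2*pi} (\<lambda>t. f (bernstein_param rho t) * ellipse_deriv rho t)"
    using ellipse_param_bound[OF rho cont] by blast
  let ?c = "hyp_coeff (real n + 1) (1 - lam) (real n + lam + 1)"
  define F where "F = (\<lambda>t. f (bernstein_param rho t) * ellipse_deriv rho t)"
  define g where "g = (\<lambda>j t. F t * inverse (ellipse_u rho t) ^ (n + 1) * (complex_of_real (?c j) * (inverse (ellipse_u rho t) ^ 2) ^ j))"
  have gi: "g j integrable_on {0..2 * pi}" for j
    unfolding g_def using rho B(3)
    by (intro integrable_continuous_interval continuous_intros) (auto simp: ellipse_u_nz F_def)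
  have r1: "inverse rho ^ 2 < 1" "0 \<le> inverse rho ^ 2" "inverse rho ^ (n + 1) \<le> 1" "0 \<le> inverse rho ^ (n + 1)"
    using rho by (auto simp: inverse_less_1_iff inverse_le_1_iff power_less_one_iff abs_square_less_1 intro!: power_le_one simp del: power_Suc power_inverse)
  have sm: "summable (\<lambda>j. \<bar>?c j\<bar> * (inverse rho ^ 2) ^ j)"
    by (rule summable_hyp_coeff) (use r1 in auto)
  have le: "norm (g j t) \<le> \<bar>?c j\<bar> * (inverse rho ^ 2) ^ j * B" if "t \<in> {0..2*pi}" for j t
  proof -
    have "norm (g j t) = norm (F t) * inverse rho ^ (n + 1) * (\<bar>?c j\<bar> * (inverse rho ^ 2) ^ j)"
      using rho by (simp add: g_def norm_mult norm_power norm_inverse norm_ellipse_u)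
    also have "\<dots> \<le> B * 1 * (\<bar>?c j\<bar> * (inverse rho ^ 2) ^ j)"
      using B r1 that unfolding F_def by (intro mult_mono) auto
    finally show ?thesis by (simp add: mult_ac)
  qed
  have G: "(\<lambda>t. \<Sum>j. g j t) = G"
  proof
    fix t
    have "norm (inverse (ellipse_u rho t) ^ 2) < 1" using r1 rho by (simp add: norm_power norm_inverse norm_ellipse_u)
    from summable_hyp_coeff_complex[OF this] show "(\<Sum>j. g j t) = G t"
      unfolding g_def G_def F_def by (rule suminf_mult)
  qed
  have *: "(\<lambda>t. \<Sum>j. g j t) integrable_on {0..2*pi}" "(\<lambda>j. integral {0..2*pi} (g j)) sums integral {0..2*pi} (\<lambda>t. \<Sum>j. g j t)"
    by (rule integral_sums_dominated[where h = "\<lambda>_. B", OF gi integrable_const_ivl sm _ _ le]; use B(1) rho in simp)+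
  show "G integrable_on {0..2*pi}" using *(1) by (simp only: G)
  have "(\<lambda>j. of_real (c_const n lam) / (of_real pi * \<i>) * integral {0..2*pi} (g j)) sums (of_real (c_const n lam) / (of_real pi * \<i>) * integral {0..2*pi} G)"
    using *(2) unfolding G by (rule sums_mult)
  also have "(\<lambda>j. of_real (c_const n lam) / (of_real pi * \<i>) * integral {0..2*pi} (g j)) =
     (\<lambda>j. ellipse_coeff rho f (n + 2 * j) * of_real (c_const n lam * ?c j))"
  proof
    fix j
    have "g j = (\<lambda>t. F t * inverse (ellipse_u rho t) ^ (n + 2 * j + 1) * of_real (?c j))"
      by (simp add: g_def power_add power_mult[symmetric] mult_ac)
    hence "integral {0..2*pi} (g j) = integral {0..2*pi} (\<lambda>t. F t * inverse (ellipse_u rho t) ^ (n + 2 * j + 1)) * of_real (?c j)"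
      by (simp only: integral_mult_left)
    thus "of_real (c_const n lam) / (of_real pi * \<i>) * integral {0..2*pi} (g j) = ellipse_coeff rho f (n + 2 * j) * of_real (c_const n lam * ?c j)"
      by (simp add: ellipse_coeff_def F_def)
  qed
  finally show "gegenbauer_coeff lam f n = of_real (c_const n lam) / (of_real pi * \<i>) * integral {0..2*pi} G"
    using gegenbauer_coeff_sums[OF lam rho f] sums_unique2 by blast
qed

section \<open>The upper bound\<close>

lemma ellipse_max_ge:
  assumes rho: "rho > 1" and f: "continuous_on (bernstein_ellipse rho) f" and t: "t \<in> {0..2*pi}"
  shows "norm (f (bernstein_param rho t)) \<le> ellipse_max rho f"
  unfolding ellipse_max_def
proof (rule cSup_upper)
  have "compact (bernstein_ellipse rho)"
    unfolding bernstein_ellipse_def using rho by (intro compact_continuous_image continuous_intros) auto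
  hence "compact ((\<lambda>z. cmod (f z)) ` bernstein_ellipse rho)"
    by (intro compact_continuous_image continuous_intros f)
  thus "bdd_above ((\<lambda>z. cmod (f z)) ` bernstein_ellipse rho)"
    by (intro bounded_imp_bdd_above compact_imp_bounded)
qed (use t in \<open>auto simp: bernstein_ellipse_def\<close>)

lemma gegenbauer_coeff_bound:
  assumes lam: "lam > -1/2" "lam \<noteq> 0" and rho: "rho > 1" and f: "f analytic_on bernstein_region rho"
  shows "cmod (gegenbauer_coeff lam f n) \<le> gegenbauer_bound lam rho f n"
proof -
  have cont: "continuous_on (bernstein_ellipse rho) f"
    using analytic_imp_holomorphic[OF f] holomorphic_on_imp_continuous_on continuous_on_subset bernstein_ellipse_subset[OF rho] by blast
  define H where "H = hyp2f1 (real n + 1) (1 - lam) (real n + lam + 1) (if lam \<le> 1 then 1 / rho\<^sup>2 else - 1 / rho\<^sup>2)"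
  define M where "M = ellipse_max rho f"
  let ?S = "\<lambda>t. \<Sum>j. complex_of_real (hyp_coeff (real n + 1) (1 - lam) (real n + lam + 1) j) * (inverse (ellipse_u rho t) ^ 2) ^ j"
  define G where "G = (\<lambda>t. f (bernstein_param rho t) * ellipse_deriv rho t * inverse (ellipse_u rho t) ^ (n + 1) * ?S t)"
  have S: "norm (?S t) \<le> H" for t
  proof -
    have n: "norm (inverse (ellipse_u rho t) ^ 2) = 1 / rho\<^sup>2"
      using rho by (simp add: norm_power norm_inverse norm_ellipse_u power_inverse) (simp add: inverse_eq_divide)
    have "1 / rho\<^sup>2 < 1" using rho by (simp add: one_less_power)
    hence "norm (inverse (ellipse_u rho t) ^ 2) < 1" unfolding n .
    thus ?thesis
      using norm_hyp_series_le_le_1[of lam "inverse (ellipse_u rho t) ^ 2" n] norm_hyp_series_le_gt_1[of lam "inverse (ellipse_u rho t) ^ 2" n] lam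
      unfolding n H_def by auto
  qed
  \<comment> \<open>Nonnegativity comes from H dominating a norm, not from the signs in the
    series.\<close>
  have H0: "H \<ge> 0" using S[of 0] norm_ge_zero order_trans by blast
  have "norm (integral {0..2*pi} G) \<le> integral {0..2*pi} (\<lambda>t. M * H / rho ^ (n + 1) * norm (ellipse_deriv rho t))"
  proof (rule integral_norm_bound_integral)
    show "G integrable_on {0..2*pi}" unfolding G_def by (rule gegenbauer_coeff_integral(1)[OF lam rho f])
    show "(\<lambda>t. M * H / rho ^ (n + 1) * norm (ellipse_deriv rho t)) integrable_on {0..2*pi}"
      using rho by (intro integrable_continuous_interval continuous_intros) auto
    fix t assume t: "t \<in> {0..2*pi}"
    have "norm (G t) = norm (f (bernstein_param rho t)) * norm (?S t) * (inverse rho ^ (n + 1) * norm (ellipse_deriv rho t))"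
      using rho by (simp add: G_def norm_mult norm_power norm_inverse norm_ellipse_u)
    also have "\<dots> \<le> M * H * (inverse rho ^ (n + 1) * norm (ellipse_deriv rho t))"
      using rho S ellipse_max_ge[OF rho cont t] H0 order_trans[OF norm_ge_zero ellipse_max_ge[OF rho cont t]]
      unfolding M_def by (intro mult_right_mono mult_mono) auto
    also have "\<dots> = M * H / rho ^ (n + 1) * norm (ellipse_deriv rho t)"
      by (simp add: power_inverse divide_inverse)
    finally show "norm (G t) \<le> M * H / rho ^ (n + 1) * norm (ellipse_deriv rho t)" .
  qed
  also have "\<dots> = M * H / rho ^ (n + 1) * bernstein_length rho"
    unfolding bernstein_length_eq[OF rho] by (rule integral_mult_right)
  finally have I: "norm (integral {0..2*pi} G) \<le> M * H / rho ^ (n + 1) * bernstein_length rho" .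
  have "cmod (gegenbauer_coeff lam f n) = \<bar>c_const n lam\<bar> / pi * norm (integral {0..2*pi} G)"
    unfolding gegenbauer_coeff_integral(2)[OF lam rho f] G_def by (simp add: norm_mult norm_divide)
  also have "\<dots> \<le> \<bar>c_const n lam\<bar> / pi * (M * H / rho ^ (n + 1) * bernstein_length rho)"
    by (intro mult_left_mono I) auto
  \<comment> \<open>For lam > 1 the bound carries c_n without absolute value, which agrees because
    c_n > 0.\<close>
  also have "\<dots> = gegenbauer_bound lam rho f n"
    using c_const_pos[of lam n] by (auto simp: gegenbauer_bound_def H_def M_def mult_ac)
  finally show ?thesis .
qed

section \<open>Optimality: the test functions U_n\<close>

lemma gegenbauer_coeff_chebU:
  assumes lam: "lam > -1/2" "lam \<noteq> 0"
  shows "gegenbauer_coeff lam (chebU n) n = of_real (c_const n lam)"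
proof -
  have "((\<lambda>x. complex_of_real ((1 - x\<^sup>2) powr (lam - 1/2) * (gegenbauer n lam x * chebU n x))) has_integral of_real (gegenbauer_moment lam n n)) {-1..1}"
    unfolding gegenbauer_moment_def
    by (intro has_integral_of_real integrable_integral weight_integrable lam continuous_intros continuous_on_chebU)
  also have "(\<lambda>x. complex_of_real ((1 - x\<^sup>2) powr (lam - 1/2) * (gegenbauer n lam x * chebU n x))) =
     (\<lambda>x. complex_of_real ((1 - x\<^sup>2) powr (lam - 1/2) * gegenbauer n lam x) * chebU n (of_real x))"
    by (simp add: chebU_of_real mult_ac)
  finally have "gegenbauer_coeff lam (chebU n) n = of_real (1 / gegenbauer_h n lam) * of_real (gegenbauer_moment lam n n)"
    unfolding gegenbauer_coeff_def by (simp only: integral_unique)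
  \<comment> \<open>The diagonal moment is h_n * c_n, as the zeroth hypergeometric coefficient is
    1.\<close>
  thus ?thesis
    using gegenbauer_moment_eq[OF lam, of n n] moment_table_diag[of lam n 0] moment_closed_eq[OF lam, of n 0] gegenbauer_h_nz[OF lam, of n]
    by (simp add: hyp_coeff_def)
qed

text \<open>The size of rho serves two estimates: rho >= 2 gives |U_n| <= 2 rho^n, and 4 (1 + |lam|)
  / rho^2 = 2 / rho <= 1 gives |2F1| <= 2. The constant 4 is the product of these bounds; the
  remaining 1 / (pi rho) is at most 1.\<close>

lemma gegenbauer_bound_chebU:
  assumes lam: "lam > -1/2"
  defines "rho \<equiv> 2 * (1 + \<bar>lam\<bar>)"
  shows "\<bar>gegenbauer_bound lam rho (chebU n) n\<bar> \<le> 4 * \<bar>bernstein_length rho\<bar> * \<bar>c_const n lam\<bar>"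
proof -
  have rho: "rho \<ge> 2" "rho > 1" by (auto simp: rho_def)
  let ?M = "ellipse_max rho (chebU n)"
  have cont: "continuous_on (bernstein_ellipse rho) (chebU n :: complex \<Rightarrow> complex)"
    using chebU_analytic analytic_imp_holomorphic holomorphic_on_imp_continuous_on by blast
  have M0: "?M \<ge> 0"
    by (rule order_trans[OF norm_ge_zero ellipse_max_ge[OF rho(2) cont, of 0]]) simp
  have M: "?M \<le> 2 * rho ^ n"
    unfolding ellipse_max_def
  proof (rule cSup_least)
    fix y assume "y \<in> (\<lambda>z. cmod (chebU n z)) ` bernstein_ellipse rho"
    then obtain t where "y = cmod (chebU n (bernstein_param rho t))" by (auto simp: bernstein_ellipse_def)
    thus "y \<le> 2 * rho ^ n"
      using norm_chebU_joukowski_le[of "ellipse_u rho t" n] rho by (simp add: bernstein_param_eq norm_ellipse_u)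
  qed (auto simp: bernstein_ellipse_def)
  have x: "\<bar>1 / rho\<^sup>2\<bar> * (4 * (1 + \<bar>lam\<bar>)) \<le> 1"
  proof -
    have "4 * (1 + \<bar>lam\<bar>) = 2 * rho" by (simp add: rho_def)
    hence "\<bar>1 / rho\<^sup>2\<bar> * (4 * (1 + \<bar>lam\<bar>)) = 2 / rho"
      using rho by (simp only:) (simp add: power2_eq_square)
    thus ?thesis using rho by simp
  qed
  define H where "H = hyp2f1 (real n + 1) (1 - lam) (real n + lam + 1) (if lam \<le> 1 then 1 / rho\<^sup>2 else - 1 / rho\<^sup>2)"
  have H: "\<bar>H\<bar> \<le> 2" unfolding H_def by (rule abs_hyp2f1_le_2[OF lam]) (use x in auto)
  have "\<bar>gegenbauer_bound lam rho (chebU n) n\<bar> = \<bar>c_const n lam\<bar> * \<bar>bernstein_length rho\<bar> * (?M * \<bar>H\<bar> / (pi * rho ^ (n + 1)))"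
    using M0 rho by (auto simp: gegenbauer_bound_def H_def abs_mult abs_divide power_abs)
  also have "\<dots> \<le> \<bar>c_const n lam\<bar> * \<bar>bernstein_length rho\<bar> * 4"
  proof (intro mult_left_mono)
    have "?M * \<bar>H\<bar> / (pi * rho ^ (n + 1)) \<le> (2 * rho ^ n) * 2 / (pi * rho ^ (n + 1))"
      using M M0 H rho by (intro divide_right_mono mult_mono) auto
    also have "\<dots> = 4 / (pi * rho)" using rho by simp
    also have "\<dots> \<le> 4"
    proof -
      have "1 * 1 \<le> pi * rho" using rho pi_ge_two by (intro mult_mono) auto
      thus ?thesis using rho by (simp add: divide_le_eq)
    qed
    finally show "?M * \<bar>H\<bar> / (pi * rho ^ (n + 1)) \<le> 4" .
  qed auto
  finally show ?thesis by (simp add: mult_ac)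
qed

theorem theorem4p1:
  fixes lam :: real
  assumes "lam > - 1/2" and "lam \<noteq> 0"
  shows "(\<forall>rho f n. rho > 1 \<longrightarrow> f analytic_on bernstein_region rho \<longrightarrow>
            cmod (gegenbauer_coeff lam f n) \<le> gegenbauer_bound lam rho f n)
       \<and> \<not> (\<exists>\<delta> > 0. \<exists>d :: nat \<Rightarrow> real. d \<in> O(\<lambda>n. real n powr (- \<delta>)) \<and>
            (\<forall>rho f n. rho > 1 \<longrightarrow> f analytic_on bernstein_region rho \<longrightarrow>
               cmod (gegenbauer_coeff lam f n) \<le> d n * gegenbauer_bound lam rho f n))"
proof (intro conjI notI allI impI)
  show "cmod (gegenbauer_coeff lam f n) \<le> gegenbauer_bound lam rho f n"
    if "rho > 1" "f analytic_on bernstein_region rho" for rho f n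
    using gegenbauer_coeff_bound[OF assms that] .
next
  assume "\<exists>\<delta> > 0. \<exists>d :: nat \<Rightarrow> real. d \<in> O(\<lambda>n. real n powr (- \<delta>)) \<and>
            (\<forall>rho f n. rho > 1 \<longrightarrow> f analytic_on bernstein_region rho \<longrightarrow>
               cmod (gegenbauer_coeff lam f n) \<le> d n * gegenbauer_bound lam rho f n)"
  then obtain \<delta> d where \<delta>: "\<delta> > 0" and d: "d \<in> O(\<lambda>n. real n powr (- \<delta>))"
    and *: "\<And>rho f n. rho > 1 \<Longrightarrow> f analytic_on bernstein_region rho \<Longrightarrow>
               cmod (gegenbauer_coeff lam f n) \<le> d n * gegenbauer_bound lam rho f n" by blast
  \<comment> \<open>The value from \<open>gegenbauer_bound_chebU\<close>; it depends on lam alone,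
    so C is independent of n.\<close>
  define rho where "rho = 2 * (1 + \<bar>lam\<bar>)"
  define C where "C = 4 * \<bar>bernstein_length rho\<bar>"
  have rho: "rho > 1" by (simp add: rho_def)
  \<comment> \<open>Since c_n is nonzero and occurs on both sides, it cancels and leaves a positive
    lower bound for |d n|. The absolute values allow for negative d n.\<close>
  have ge: "1 \<le> C * \<bar>d n\<bar>" for n
  proof -
    have "\<bar>c_const n lam\<bar> \<le> d n * gegenbauer_bound lam rho (chebU n) n"
      using *[OF rho chebU_analytic, of n n] unfolding gegenbauer_coeff_chebU[OF assms] by simp
    also have "\<dots> \<le> \<bar>d n\<bar> * \<bar>gegenbauer_bound lam rho (chebU n) n\<bar>"
      unfolding abs_mult[symmetric] by simp
    also have "\<dots> \<le> \<bar>d n\<bar> * (C * \<bar>c_const n lam\<bar>)"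
      using gegenbauer_bound_chebU[OF assms(1), of n] by (intro mult_left_mono) (auto simp: rho_def C_def)
    finally have "1 * \<bar>c_const n lam\<bar> \<le> (C * \<bar>d n\<bar>) * \<bar>c_const n lam\<bar>" by (simp add: mult_ac)
    thus ?thesis using c_const_nz[OF assms, of n] by simp
  qed
  \<comment> \<open>The order O(n^(-\<delta>)) with \<delta> > 0 forces d to tend to 0, against that
    lower bound.\<close>
  obtain K where "eventually (\<lambda>n. norm (d n) \<le> K * norm (real n powr (- \<delta>))) sequentially"
    using landau_o.bigE[OF d] by blast
  moreover have "(\<lambda>n. real n powr (- \<delta>)) \<longlonglongrightarrow> 0"
    by (rule tendsto_neg_powr[OF _ filterlim_real_sequentially]) (use \<delta> in simp)
  hence "(\<lambda>n. K * norm (real n powr (- \<delta>))) \<longlonglongrightarrow> 0"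
    by (intro tendsto_mult_right_zero tendsto_norm_zero)
  ultimately have "d \<longlonglongrightarrow> 0"
    by (rule Lim_null_comparison)
  hence "((\<lambda>n. C * \<bar>d n\<bar>) \<longlongrightarrow> C * \<bar>0\<bar>) sequentially"
    by (intro tendsto_mult tendsto_const tendsto_rabs)
  hence "1 \<le> C * \<bar>0\<bar>" using ge by (intro LIMSEQ_le_const) auto
  thus False by simp
qed

end
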